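(* Let $\mathbb{T}=\mathbb{S}^1(\tfrac12)\times\mathbb{S}^1(\tfrac12)$ and let $\varphi:\mathbb{T}\to\mathbb{S}^3(\tfrac1{\sqrt2})\subset\mathbb{R}^4$, $\varphi(\gamma,\vartheta)=\big(\tfrac12\cos\gamma,\tfrac12\sin\gamma,\tfrac12\cos\vartheta,\tfrac12\sin\vartheta\big)$, be the minimal Clifford torus. Then (i) $\mathrm{Index}_{\rm harm}(\varphi)=4$; (ii) $\mathrm{Null}_{\rm harm}(\varphi)=7$.
   Context: $\mathbb{S}^n(R)$ is the Euclidean $n$-sphere of radius $R$; $\mathbb{T}$ carries the product metric $\frac14(d\gamma^2+d\vartheta^2)$ in the angular coordinates $\gamma,\vartheta\in[0,2\pi]$. For a smooth map $\phi:M\to N$ with $M$ compact, the energy is $E(\phi)=\frac12\int_M|d\phi|^2\,dv_M$ and harmonic maps are its critical points. The Jacobi operator $J=J^\phi$ of a harmonic map $\phi$ is the second-order elliptic self-adjoint operator on smooth sections of $\phi^{-1}TN$ determined by $\frac{\partial^2}{\partial t\,\partial s}\big|_{(0,0)}E(\phi_{t,s})=\int_M\langle J(V),W\rangle\,dv_M$ for every two-parameter variation $\phi_{t,s}$ of $\phi$ with $V=\partial_t\phi_{t,0}|_{t=0}$, $W=\partial_s\phi_{0,s}|_{s=0}$. For the minimal Clifford torus, $J(V)=\overline\Delta V-4V+2V^\top$, where $V^\top$ is the component of $V$ tangent to $\varphi(\mathbb{T})$ and $\overline\Delta=-\sum_i(\nabla^\varphi_{e_i}\nabla^\varphi_{e_i}-\nabla^\varphi_{\nabla^{\mathbb{T}}_{e_i}e_i})$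 is the rough Laplacian. $\mathrm{Index}_{\rm harm}(\phi)$ is the sum of the dimensions of the eigenspaces of $J^\phi$ with negative eigenvalue, and $\mathrm{Null}_{\rm harm}(\phi)=\dim\mathrm{Ker}(J^\phi)$. *)

theory Defs
  imports "HOL-Analysis.Analysis" "HOL-Library.Function_Algebras" "HOL-Library.Extended_Nat"
begin

instantiation "fun" :: (type, real_vector) real_vector
begin

definition scaleR_fun :: "real \<Rightarrow> ('a \<Rightarrow> 'b) \<Rightarrow> 'a \<Rightarrow> 'b" where
  "scaleR_fun r f = (\<lambda>x. r *\<^sub>R f x)"

instance
  by standard (simp_all add: scaleR_fun_def fun_eq_iff scaleR_add_right scaleR_add_left)

end

text \<open>The library's \<^const>\<open>dim\<close> is \<open>0\<close> on infinite-dimensional subspaces; here these get \<open>\<infinity>\<close>.\<close>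

definition edim :: "'a::real_vector set \<Rightarrow> enat" where
  "edim S = (if \<exists>B. finite B \<and> S \<subseteq> span B then enat (dim S) else \<infinity>)"

text \<open>The set \<open>S\<close> is open in all uses, hence the unrestricted \<open>at x\<close>.\<close>

fun Ck_on :: "nat \<Rightarrow> 'a::real_normed_vector set \<Rightarrow> ('a \<Rightarrow> 'b::real_normed_vector) \<Rightarrow> bool" where
  "Ck_on 0 S f \<longleftrightarrow> continuous_on S f"
| "Ck_on (Suc k) S f \<longleftrightarrow>
     (\<forall>x\<in>S. f differentiable (at x)) \<and> (\<forall>v. Ck_on k S (\<lambda>x. frechet_derivative f (at x) v))"

definition smooth_on :: "'a::real_normed_vector set \<Rightarrow> ('a \<Rightarrow> 'b::real_normed_vector) \<Rightarrow> bool" where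
  "smooth_on S f \<longleftrightarrow> (\<forall>k. Ck_on k S f)"

text \<open>
  The torus is the plane of angular coordinates \<open>(\<gamma>, \<vartheta>)\<close> modulo \<open>2\<pi>\<close> in each variable, so
  functions on it are doubly periodic functions on the plane. In the metric
  \<open>(d\<gamma>\<^sup>2 + d\<vartheta>\<^sup>2) / 4\<close> the vectors \<open>2 \<partial>/\<partial>\<gamma>\<close>, \<open>2 \<partial>/\<partial>\<vartheta>\<close> form an orthonormal frame and the area
  element is \<open>d\<gamma> d\<vartheta> / 4\<close>.
\<close>

definition doubly_periodic :: "(real \<times> real \<Rightarrow> 'a) \<Rightarrow> bool" where
  "doubly_periodic f \<longleftrightarrow> (\<forall>x. f (x + (2 * pi, 0)) = f x \<and> f (x + (0, 2 * pi)) = f x)"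

definition torus_frame :: "(real \<times> real) set" where
  "torus_frame = {(2, 0), (0, 2)}"

definition torus_integral :: "(real \<times> real \<Rightarrow> real) \<Rightarrow> real" where
  "torus_integral f = integral (cbox (0, 0) (2 * pi, 2 * pi)) (\<lambda>x. f x * (1 / 4))"

definition torus_sphere_map :: "real \<Rightarrow> (real \<times> real \<Rightarrow> 'n::euclidean_space) \<Rightarrow> bool" where
  "torus_sphere_map R u \<longleftrightarrow>
     smooth_on UNIV u \<and> doubly_periodic u \<and> (\<forall>x. u x \<in> sphere 0 R)"

definition energy :: "(real \<times> real \<Rightarrow> 'n::euclidean_space) \<Rightarrow> real" where
  "energy u = 1 / 2 *
     torus_integral (\<lambda>x. \<Sum>e\<in>torus_frame. (norm (frechet_derivative u (at x) e))\<^sup>2)"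

text \<open>
  Smooth sections of the pull-back by \<open>u\<close> of the tangent bundle of a sphere centred at \<open>0\<close>: the
  tangent space at \<open>u x\<close> is the orthogonal complement of \<open>u x\<close>.
\<close>

definition sections :: "(real \<times> real \<Rightarrow> 'n::euclidean_space) \<Rightarrow> (real \<times> real \<Rightarrow> 'n) set" where
  "sections u = {V. smooth_on UNIV V \<and> doubly_periodic V \<and> (\<forall>x. V x \<bullet> u x = 0)}"

definition variation2 ::
  "real \<Rightarrow> (real \<times> real \<Rightarrow> 'n::euclidean_space) \<Rightarrow> (real \<Rightarrow> real \<Rightarrow> real \<times> real \<Rightarrow> 'n) \<Rightarrow> bool" where
  "variation2 R u \<Phi> \<longleftrightarrow>
     (\<exists>\<epsilon>>0. smooth_on ({-\<epsilon><..<\<epsilon>} \<times> {-\<epsilon><..<\<epsilon>} \<times> UNIV) (\<lambda>(t, s, x). \<Phi> t s x) \<and>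
            (\<forall>t\<in>{-\<epsilon><..<\<epsilon>}. \<forall>s\<in>{-\<epsilon><..<\<epsilon>}. torus_sphere_map R (\<Phi> t s))) \<and>
     \<Phi> 0 0 = u"

text \<open>
  The Jacobi operator of a harmonic map \<open>u\<close> into the sphere of radius \<open>R\<close>: \<open>jacobi R u V\<close> is
  the unique section representing the Hessian of the energy at \<open>u\<close> in the direction \<open>V\<close>.
\<close>

definition jacobi ::
  "real \<Rightarrow> (real \<times> real \<Rightarrow> 'n::euclidean_space) \<Rightarrow> (real \<times> real \<Rightarrow> 'n) \<Rightarrow> real \<times> real \<Rightarrow> 'n" where
  "jacobi R u V = (THE U. U \<in> sections u \<and>
     (\<forall>\<Phi>. variation2 R u \<Phi> \<and> (\<forall>x. vector_derivative (\<lambda>t. \<Phi> t 0 x) (at 0) = V x) \<longrightarrow>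
        deriv (\<lambda>t. deriv (\<lambda>s. energy (\<Phi> t s)) 0) 0 =
        torus_integral (\<lambda>x. U x \<bullet> vector_derivative (\<lambda>s. \<Phi> 0 s x) (at 0))))"

definition jacobi_eigenspace ::
  "real \<Rightarrow> (real \<times> real \<Rightarrow> 'n::euclidean_space) \<Rightarrow> real \<Rightarrow> (real \<times> real \<Rightarrow> 'n) set" where
  "jacobi_eigenspace R u c = {V \<in> sections u. jacobi R u V = c *\<^sub>R V}"

text \<open>
  The sum over all negative \<open>c\<close> of the dimensions of the eigenspaces, as a supremum of finite
  partial sums; a \<open>c\<close> that is not an eigenvalue contributes \<open>0\<close>.
\<close>

definition index_harm :: "real \<Rightarrow> (real \<times> real \<Rightarrow> 'n::euclidean_space) \<Rightarrow> enat" where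
  "index_harm R u =
     (SUP F\<in>{F. finite F \<and> F \<subseteq> {..<0}}. \<Sum>c\<in>F. edim (jacobi_eigenspace R u c))"

definition null_harm :: "real \<Rightarrow> (real \<times> real \<Rightarrow> 'n::euclidean_space) \<Rightarrow> enat" where
  "null_harm R u = edim {V \<in> sections u. jacobi R u V = 0}"

definition clifford_torus :: "real \<times> real \<Rightarrow> real ^ 4" where
  "clifford_torus = (\<lambda>(\<gamma>, \<theta>). vector [cos \<gamma> / 2, sin \<gamma> / 2, cos \<theta> / 2, sin \<theta> / 2])"

end

theory Submission
  imports Defs
begin

text \<open>
  Normalising \<open>u + t V + s W\<close> realises all pairs of sections as velocities, so differentiating
  the energy twice under the integral and integrating by parts identifies the Jacobi operator of
  a map \<open>u\<close> into a sphere with \<open>\<Delta> u = - \<kappa> u\<close> as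
  \<open>V \<mapsto> - \<Delta> V - \<kappa> V\<close> followed by the projection onto \<open>u\<^sup>\<bottom>\<close>. For the Clifford torus, in the
  orthogonal frame of the two unit tangents and the normal, it maps trigonometric modes
  of frequency \<open>(m, n)\<close> to such modes. As it is self-adjoint, pairing an eigensection for
  the eigenvalue \<open>c\<close> with these modes gives linear equations between Fourier coefficients,
  and a nonzero coefficient forces \<open>(c - 4 k)\<^sup>2 = 32 k\<close> with \<open>k = m\<^sup>2 + n\<^sup>2\<close>, or \<open>c = 4 k\<close> in the
  tangential components. For \<open>c < 0\<close> only \<open>k = 1\<close> and \<open>c = 4 - 4 \<surd>2\<close> survive (four modes); for
  \<open>c = 0\<close> the modes with \<open>k = 2\<close> (four) and the constants (three). Completeness of
  the trigonometric system does the rest.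
\<close>

section \<open>Calculus of \<open>C\<^sup>k\<close> functions\<close>

text \<open>The definite description in \<open>jacobi\<close> must be shown to have a unique
  solution before any spectral argument can start: uniqueness needs enough variations, existence
  needs the Hessian to depend on the two velocities only. The mixed second derivative of the
  variation does enter, but harmonicity makes the energy see only its component along
  \<open>u\<close>, and the sphere constraint expresses that component by the velocities.
  Eigensections are never expanded in a series; only their pairings with modes are compared, so no
  question of convergence arises. On frequency \<open>(m, n)\<close> the operator is
  \<open>4 k\<close> plus a coupling of the normal to one tangential direction, with square
  \<open>32 k\<close>; hence the eigenvalues \<open>4 k\<close>, \<open>4 k - 4 sqrt (2 k)\<close>
  and \<open>4 k + 4 sqrt (2 k)\<close>. The only negative value occurs at \<open>k = 1\<close>, the
  value zero at \<open>k = 2\<close> and \<open>k = 0\<close>. The frequencies \<open>(m, n)\<close>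
  and \<open>(- m, - n)\<close> carry the same functions, so the four lattice points with
  \<open>k = 1\<close> amount to two frequencies with two phases each, and likewise for
  \<open>k = 2\<close>.\<close>

definition dird :: "'a::real_normed_vector \<Rightarrow> ('a \<Rightarrow> 'b::real_normed_vector) \<Rightarrow> 'a \<Rightarrow> 'b" where
  "dird v f x = frechet_derivative f (at x) v"

lemma dird_eqI: "(f has_derivative f') (at x) \<Longrightarrow> dird v f x = f' v"
  unfolding dird_def by (metis frechet_derivative_at)

lemma Ck_on_Suc_dird:
  "Ck_on (Suc k) S f \<longleftrightarrow> (\<forall>x\<in>S. f differentiable (at x)) \<and> (\<forall>v. Ck_on k S (dird v f))"
  by (simp add: dird_def[abs_def])

text \<open>If \<open>f\<close> is not differentiable at \<open>x\<close>, neither is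
  \<open>g\<close>; both derivative predicates are then constantly false, and the choice operator in
  \<open>frechet_derivative\<close> returns the same value for both.\<close>

lemma dird_cong_open:
  assumes "open S" "x \<in> S" "\<And>y. y \<in> S \<Longrightarrow> f y = g y"
  shows "dird v f x = dird v g x"
proof (cases "f differentiable (at x)")
  case True
  then have f: "(f has_derivative frechet_derivative f (at x)) (at x)"
    by (simp add: frechet_derivative_works)
  then have "(g has_derivative frechet_derivative f (at x)) (at x)"
    using assms by (rule has_derivative_transform_within_open)
  from dird_eqI[OF this] show ?thesis by (simp add: dird_def)
next
  case False
  have "\<not> g differentiable (at x)"
  proof
    assume "g differentiable (at x)"
    then obtain g' where "(g has_derivative g') (at x)" by (auto simp: differentiable_def)
    then have "(f has_derivative g') (at x)"
      using assms(1,2) by (rule has_derivative_transform_within_open) (simp add: assms(3))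
    with False show False by (auto simp: differentiable_def)
  qed
  with False have "(\<lambda>f'. (f has_derivative f') (at x)) = (\<lambda>f'. (g has_derivative f') (at x))"
    by (auto simp: differentiable_def)
  then show ?thesis by (simp add: dird_def frechet_derivative_def)
qed

lemma Ck_on_cong:
  assumes "open S" "\<And>x. x \<in> S \<Longrightarrow> f x = g x" "Ck_on k S f"
  shows "Ck_on k S g"
  using assms(2,3)
proof (induction k arbitrary: f g)
  case 0
  then show ?case by (metis Ck_on.simps(1) continuous_on_cong)
next
  case (Suc k)
  have "g differentiable (at x)" if "x \<in> S" for x
  proof -
    from that Suc.prems(2) obtain f' where "(f has_derivative f') (at x)"
      by (auto simp: differentiable_def)
    then have "(g has_derivative f') (at x)"
      using assms(1) that Suc.prems(1) by (rule has_derivative_transform_within_open)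
    then show ?thesis by (auto simp: differentiable_def)
  qed
  moreover have "Ck_on k S (dird v g)" for v
  proof (rule Suc.IH)
    show "Ck_on k S (dird v f)" using Suc.prems(2) unfolding Ck_on_Suc_dird by blast
    show "dird v f x = dird v g x" if "x \<in> S" for x
      using assms(1) that Suc.prems(1) by (rule dird_cong_open)
  qed
  ultimately show ?case unfolding Ck_on_Suc_dird by blast
qed

text \<open>The working criterion for raising the order: a formula for the derivative that holds on
  \<open>S\<close> is enough, since openness lets \<open>Ck_on_cong\<close> exchange it for
  \<open>dird v f\<close>.\<close>

lemma Ck_on_SucI:
  assumes "open S" "\<And>x. x \<in> S \<Longrightarrow> (f has_derivative f' x) (at x)"
    "\<And>v. Ck_on k S (\<lambda>x. f' x v)"
  shows "Ck_on (Suc k) S f"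
  unfolding Ck_on_Suc_dird
proof (intro conjI ballI allI)
  show "f differentiable (at x)" if "x \<in> S" for x
    using assms(2)[OF that] by (auto simp: differentiable_def)
  show "Ck_on k S (dird v f)" for v
    using assms(1) _ assms(3)[of v]
    by (rule Ck_on_cong) (simp add: dird_eqI[OF assms(2)])
qed

lemma Ck_on_SucD_has_derivative:
  "Ck_on (Suc k) S f \<Longrightarrow> x \<in> S \<Longrightarrow> (f has_derivative (\<lambda>v. dird v f x)) (at x)"
  unfolding dird_def by (simp add: frechet_derivative_works[symmetric])

lemma Ck_on_SucD_dird: "Ck_on (Suc k) S f \<Longrightarrow> Ck_on k S (dird v f)"
  unfolding Ck_on_Suc_dird by blast

lemma Ck_on_SucD: "Ck_on (Suc k) S f \<Longrightarrow> Ck_on k S f"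
proof (induction k arbitrary: f)
  case 0
  then show ?case
    by (auto intro!: continuous_at_imp_continuous_on differentiable_imp_continuous_within)
next
  case (Suc k)
  then show ?case unfolding Ck_on_Suc_dird[of "Suc k"] Ck_on_Suc_dird[of k] by blast
qed

lemma Ck_on_const: "Ck_on k S (\<lambda>x. c)"
proof (induction k arbitrary: c)
  case 0
  then show ?case by simp
next
  case (Suc k)
  have "dird v (\<lambda>x::'a. c) = (\<lambda>x. 0)" for v
    by (rule ext) (rule dird_eqI[OF has_derivative_const])
  then show ?case using Suc[of 0] unfolding Ck_on_Suc_dird by simp
qed

lemma Ck_on_bounded_linear:
  assumes "open S" "bounded_linear f"
  shows "Ck_on k S f"
proof (cases k)
  case 0
  then show ?thesis using assms(2) by (simp add: linear_continuous_on)
next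
  case (Suc j)
  show ?thesis unfolding Suc using assms(1)
    by (rule Ck_on_SucI[where f'="\<lambda>_. f"])
      (auto intro: bounded_linear_imp_has_derivative assms Ck_on_const)
qed

lemma Ck_on_add:
  assumes "open S" "Ck_on k S f" "Ck_on k S g"
  shows "Ck_on k S (\<lambda>x. f x + g x)"
  using assms(2,3)
proof (induction k arbitrary: f g)
  case 0
  then show ?case by (simp add: continuous_on_add)
next
  case (Suc k)
  show ?case using assms(1)
    by (rule Ck_on_SucI[OF _ has_derivative_add[OF Ck_on_SucD_has_derivative Ck_on_SucD_has_derivative]])
      (use Suc in \<open>auto intro: Ck_on_SucD_dird simp del: Ck_on.simps\<close>)
qed

text \<open>One induction serves scalar multiples, inner products and products: by the Leibniz rule
  the derivative is a sum of two such products, one factor differentiated and the other demoted to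
  order \<open>k\<close>.\<close>

lemma (in bounded_bilinear) Ck_on:
  assumes "open S" "Ck_on k S f" "Ck_on k S g"
  shows "Ck_on k S (\<lambda>x. prod (f x) (g x))"
  using assms(2,3)
proof (induction k arbitrary: f g)
  case 0
  then show ?case by (simp add: continuous_on)
next
  case (Suc k)
  show ?case using assms(1)
    by (rule Ck_on_SucI[OF _ FDERIV[OF Ck_on_SucD_has_derivative Ck_on_SucD_has_derivative]])
      (use Suc in \<open>auto intro!: Ck_on_add assms(1) Suc.IH intro: Ck_on_SucD Ck_on_SucD_dird simp del: Ck_on.simps\<close>)
qed

text \<open>Proved jointly because the derivative of each involves the other.\<close>

lemma Ck_on_sin_cos:
  fixes g :: "'a::real_normed_vector \<Rightarrow> real"
  assumes "open S" "Ck_on k S g"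
  shows "Ck_on k S (\<lambda>x. sin (g x)) \<and> Ck_on k S (\<lambda>x. cos (g x))"
  using assms(2)
proof (induction k)
  case 0
  then show ?case by (auto intro: continuous_intros)
next
  case (Suc k)
  have g: "(g has_derivative (\<lambda>v. dird v g x)) (at x)" if "x \<in> S" for x
    using Suc.prems that by (rule Ck_on_SucD_has_derivative)
  have IH: "Ck_on k S (\<lambda>x. sin (g x))" "Ck_on k S (\<lambda>x. cos (g x))"
    using Suc.IH[OF Ck_on_SucD[OF Suc.prems]] by auto
  have "Ck_on (Suc k) S (\<lambda>x. sin (g x))"
    by (rule Ck_on_SucI[OF assms(1), where f'="\<lambda>x v. dird v g x * cos (g x)"])
      (auto intro!: derivative_eq_intros g bounded_bilinear.Ck_on[OF bounded_bilinear_mult] assms(1)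
        IH Ck_on_SucD_dird Suc.prems simp del: Ck_on.simps)
  \<comment> \<open>Writing the derivative with \<open>- 1 * sin (g x)\<close> keeps it a product,
    to which the bilinear closure rule applies twice.\<close>
  moreover have "Ck_on (Suc k) S (\<lambda>x. cos (g x))"
  proof (rule Ck_on_SucI[OF assms(1), where f'="\<lambda>x v. dird v g x * (- 1 * sin (g x))"])
    show "((\<lambda>x. cos (g x)) has_derivative (\<lambda>v. dird v g x * (- 1 * sin (g x)))) (at x)"
      if "x \<in> S" for x
      using that by (auto intro!: derivative_eq_intros g)
    show "Ck_on k S (\<lambda>x. dird v g x * (- 1 * sin (g x)))" for v
      by (intro bounded_bilinear.Ck_on[OF bounded_bilinear_mult] assms(1)
        IH Ck_on_SucD_dird Suc.prems Ck_on_const)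
  qed
  ultimately show ?case ..
qed

text \<open>The exponent varies in the induction because differentiation lowers it by one.\<close>

lemma Ck_on_powr:
  fixes g :: "'a::real_normed_vector \<Rightarrow> real"
  assumes "open S" "Ck_on k S g" "\<And>x. x \<in> S \<Longrightarrow> g x > 0"
  shows "Ck_on k S (\<lambda>x. g x powr p)"
  using assms(2)
proof (induction k arbitrary: p)
  case 0
  then show ?case
    by (auto intro!: continuous_on_powr continuous_on_const) (use assms(3) in force)
next
  case (Suc k)
  have g: "(g has_derivative (\<lambda>v. dird v g x)) (at x)" if "x \<in> S" for x
    using Suc.prems that by (rule Ck_on_SucD_has_derivative)
  have IH: "Ck_on k S (\<lambda>x. g x powr q)" for q
    using Suc.IH[OF Ck_on_SucD[OF Suc.prems]] .
  show ?case
  proof (rule Ck_on_SucI[OF assms(1), where f'="\<lambda>x v. dird v g x * (p * g x powr (p - 1))"])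
    show "((\<lambda>x. g x powr p) has_derivative (\<lambda>v. dird v g x * (p * g x powr (p - 1)))) (at x)"
      if "x \<in> S" for x
      by (rule has_derivative_eq_rhs[OF has_derivative_powr[OF g[OF that] has_derivative_const]])
        (use assms(3)[OF that] in \<open>auto simp: powr_diff field_simps\<close>)
  qed (auto intro!: bounded_bilinear.Ck_on[OF bounded_bilinear_mult] assms(1)
        IH Ck_on_SucD_dird Suc.prems Ck_on_const simp del: Ck_on.simps)
qed

text \<open>The derivative of a linear map is the map itself, so the induction stays among functions
  of the form \<open>f (L x)\<close>. Used for slices of a variation and for pulling back along
  projections.\<close>

lemma Ck_on_compose_linear:
  assumes "open S" "open T" "bounded_linear L" "L ` S \<subseteq> T" "Ck_on k T f"
  shows "Ck_on k S (\<lambda>x. f (L x))"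
  using assms(5)
proof (induction k arbitrary: f)
  case 0
  then show ?case using assms
    by (auto intro: continuous_on_compose2[of T f] linear_continuous_on)
next
  case (Suc k)
  show ?case
  proof (rule Ck_on_SucI[OF assms(1), where f'="\<lambda>x v. dird (L v) f (L x)"])
    show "((\<lambda>x. f (L x)) has_derivative (\<lambda>v. dird (L v) f (L x))) (at x)" if "x \<in> S" for x
      using has_derivative_compose[OF bounded_linear_imp_has_derivative[OF assms(3)]
          Ck_on_SucD_has_derivative[OF Suc.prems]] that assms(4) by blast
  qed (auto intro: Suc.IH Ck_on_SucD_dird Suc.prems simp del: Ck_on.simps)
qed

section \<open>Closure properties of smooth functions\<close>

lemma smooth_on_const: "smooth_on S (\<lambda>x. c)"
  by (simp add: smooth_on_def Ck_on_const)

lemma smooth_on_bounded_linear: "open S \<Longrightarrow> bounded_linear f \<Longrightarrow> smooth_on S f"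
  by (simp add: smooth_on_def Ck_on_bounded_linear)

lemma smooth_on_add: "open S \<Longrightarrow> smooth_on S f \<Longrightarrow> smooth_on S g \<Longrightarrow> smooth_on S (\<lambda>x. f x + g x)"
  by (simp add: smooth_on_def Ck_on_add)

lemma smooth_on_scaleR:
  "open S \<Longrightarrow> smooth_on S f \<Longrightarrow> smooth_on S g \<Longrightarrow> smooth_on S (\<lambda>x. f x *\<^sub>R g x)"
  by (simp add: smooth_on_def bounded_bilinear.Ck_on[OF bounded_bilinear_scaleR])

lemma smooth_on_inner:
  "open S \<Longrightarrow> smooth_on S f \<Longrightarrow> smooth_on S g \<Longrightarrow> smooth_on S (\<lambda>x. f x \<bullet> g x)"
  by (simp add: smooth_on_def bounded_bilinear.Ck_on[OF bounded_bilinear_inner])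

lemma smooth_on_mult:
  fixes f g :: "'a::real_normed_vector \<Rightarrow> real"
  shows "open S \<Longrightarrow> smooth_on S f \<Longrightarrow> smooth_on S g \<Longrightarrow> smooth_on S (\<lambda>x. f x * g x)"
  by (simp add: smooth_on_def bounded_bilinear.Ck_on[OF bounded_bilinear_mult])

lemma smooth_on_minus: "open S \<Longrightarrow> smooth_on S f \<Longrightarrow> smooth_on S (\<lambda>x. - f x)"
  using smooth_on_scaleR[OF _ smooth_on_const[of S "-1"]] by fastforce

lemma smooth_on_diff: "open S \<Longrightarrow> smooth_on S f \<Longrightarrow> smooth_on S g \<Longrightarrow> smooth_on S (\<lambda>x. f x - g x)"
  using smooth_on_add[OF _ _ smooth_on_minus[of S g], of f] by simp

lemma smooth_on_sin:
  fixes f :: "'a::real_normed_vector \<Rightarrow> real"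
  shows "open S \<Longrightarrow> smooth_on S f \<Longrightarrow> smooth_on S (\<lambda>x. sin (f x))"
  by (simp add: smooth_on_def Ck_on_sin_cos)

lemma smooth_on_cos:
  fixes f :: "'a::real_normed_vector \<Rightarrow> real"
  shows "open S \<Longrightarrow> smooth_on S f \<Longrightarrow> smooth_on S (\<lambda>x. cos (f x))"
  by (simp add: smooth_on_def Ck_on_sin_cos)

lemma smooth_on_powr:
  fixes f :: "'a::real_normed_vector \<Rightarrow> real"
  shows "open S \<Longrightarrow> smooth_on S f \<Longrightarrow> (\<And>x. x \<in> S \<Longrightarrow> f x > 0) \<Longrightarrow> smooth_on S (\<lambda>x. f x powr p)"
  by (simp add: smooth_on_def Ck_on_powr)

lemma smooth_on_compose_linear:
  assumes "open S" "open T" "bounded_linear L" "L ` S \<subseteq> T" "smooth_on T f"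
  shows "smooth_on S (\<lambda>x. f (L x))"
  using assms Ck_on_compose_linear unfolding smooth_on_def by blast

lemma smooth_on_sum:
  assumes "open S" "\<And>i. i \<in> I \<Longrightarrow> smooth_on S (f i)"
  shows "smooth_on S (\<lambda>x. \<Sum>i\<in>I. f i x)"
  using assms(2) by (induction I rule: infinite_finite_induct)
    (auto intro: smooth_on_const smooth_on_add assms(1))

lemma smooth_on_imp_continuous_on: "smooth_on S f \<Longrightarrow> continuous_on S f"
  unfolding smooth_on_def by (metis Ck_on.simps(1))

lemma smooth_on_dird: "smooth_on S f \<Longrightarrow> smooth_on S (dird v f)"
  unfolding smooth_on_def by (metis Ck_on_SucD_dird)

lemma smooth_on_has_derivative:
  "smooth_on S f \<Longrightarrow> x \<in> S \<Longrightarrow> (f has_derivative (\<lambda>v. dird v f x)) (at x)"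
  unfolding smooth_on_def by (metis Ck_on_SucD_has_derivative)

lemmas smooth_intros = smooth_on_const smooth_on_add smooth_on_scaleR
  smooth_on_inner smooth_on_mult smooth_on_minus smooth_on_diff smooth_on_sin smooth_on_cos
  smooth_on_sum smooth_on_dird

text \<open>The bridge from Frechet derivatives to calculus in one variable, where the fundamental
  theorem and the Leibniz rule live.\<close>

lemma smooth_on_vector_derivative_line:
  assumes "smooth_on S f" "x + \<tau> *\<^sub>R v \<in> S"
  shows "((\<lambda>\<tau>. f (x + \<tau> *\<^sub>R v)) has_vector_derivative dird v f (x + \<tau> *\<^sub>R v)) (at \<tau> within T)"
proof -
  note f = smooth_on_has_derivative[OF assms]
  have "((\<lambda>\<tau>. x + \<tau> *\<^sub>R v) has_derivative (\<lambda>h. h *\<^sub>R v)) (at \<tau> within T)"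
    by (auto intro!: derivative_eq_intros)
  from has_derivative_compose[OF this has_derivative_at_withinI[OF f]]
  have "((\<lambda>\<tau>. f (x + \<tau> *\<^sub>R v)) has_derivative (\<lambda>h. dird (h *\<^sub>R v) f (x + \<tau> *\<^sub>R v))) (at \<tau> within T)" .
  moreover have "dird (h *\<^sub>R v) f (x + \<tau> *\<^sub>R v) = h *\<^sub>R dird v f (x + \<tau> *\<^sub>R v)" for h
    using linear_cmul[OF has_derivative_linear[OF f]] .
  ultimately show ?thesis by (simp add: has_vector_derivative_def)
qed

text \<open>
  Both sides are derivatives at \<open>h = 0\<close> of
  \<open>dird v f (x + h w) - dird v f x = \<integral>\<^sub>0\<^sup>h dird v (dird w f) (x + \<tau> w) d\<tau>\<close>,
  which comes from the fundamental theorem of calculus by differentiating under the integral.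
\<close>
lemma dird_commute:
  fixes f :: "'a::real_normed_vector \<Rightarrow> 'b::euclidean_space"
  assumes "open S" "smooth_on S f" "x \<in> S"
  shows "dird v (dird w f) x = dird w (dird v f) x"
proof -
  let ?p = "\<lambda>z::real \<times> real. x + fst z *\<^sub>R v + snd z *\<^sub>R w"
  have "open (?p -` S)"
    using assms(1) by (intro open_vimage continuous_intros)
  moreover have "(0, 0) \<in> ?p -` S" using assms(3) by simp
  ultimately obtain e where e: "e > 0" "cball (0,0) e \<subseteq> ?p -` S"
    using open_contains_cball by blast
  \<comment> \<open>Half of \<open>e\<close>, because the norm of a pair is bounded by the sum of
    the norms of its entries.\<close>
  define d where "d = e / 2"
  have d: "d > 0" using e(1) by (simp add: d_def)
  have inS: "x + \<sigma> *\<^sub>R v + \<tau> *\<^sub>R w \<in> S" if "\<bar>\<sigma>\<bar> \<le> d" "\<bar>\<tau>\<bar> \<le> d" for \<sigma> \<tau>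
  proof -
    have "norm (\<sigma>, \<tau>) \<le> norm \<sigma> + norm \<tau>" by (rule norm_Pair_le)
    also have "\<dots> \<le> e" using that by (simp add: d_def)
    finally have "(\<sigma>, \<tau>) \<in> cball (0,0) e" by (simp flip: zero_prod_def)
    with e(2) show ?thesis by auto
  qed
  have cont: "continuous_on S (dird a (dird b f))" "continuous_on S (dird b f)" for a b
    using assms(2) by (auto intro: smooth_on_imp_continuous_on smooth_on_dird)
  have key: "dird v f (x + h *\<^sub>R w) - dird v f x
      = integral {0..h} (\<lambda>\<tau>. dird v (dird w f) (x + \<tau> *\<^sub>R w))" if h: "0 \<le> h" "h \<le> d" for h
  proof -
    let ?U = "{-d..d}"
    have L: "((\<lambda>\<sigma>. integral (cbox 0 h) (\<lambda>\<tau>. dird w f (x + \<sigma> *\<^sub>R v + \<tau> *\<^sub>R w))) has_vector_derivative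
      integral (cbox 0 h) (\<lambda>\<tau>. dird v (dird w f) (x + 0 *\<^sub>R v + \<tau> *\<^sub>R w))) (at 0 within ?U)"
    proof (rule leibniz_rule_vector_derivative)
      show "((\<lambda>\<sigma>. dird w f (x + \<sigma> *\<^sub>R v + \<tau> *\<^sub>R w)) has_vector_derivative
           dird v (dird w f) (x + \<sigma> *\<^sub>R v + \<tau> *\<^sub>R w)) (at \<sigma> within ?U)"
        if "\<sigma> \<in> ?U" "\<tau> \<in> cbox 0 h" for \<sigma> \<tau>
      proof -
        have "((\<lambda>\<sigma>. dird w f ((x + \<tau> *\<^sub>R w) + \<sigma> *\<^sub>R v)) has_vector_derivative
           dird v (dird w f) ((x + \<tau> *\<^sub>R w) + \<sigma> *\<^sub>R v)) (at \<sigma> within ?U)"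
          using inS[of \<sigma> \<tau>] that h
          by (intro smooth_on_vector_derivative_line[of S] smooth_on_dird assms) (auto simp: algebra_simps)
        then show ?thesis by (simp add: add_ac)
      qed
      show "(\<lambda>\<tau>. dird w f (x + \<sigma> *\<^sub>R v + \<tau> *\<^sub>R w)) integrable_on cbox 0 h" if "\<sigma> \<in> ?U" for \<sigma>
        using inS[of \<sigma>] that h
        by (intro integrable_continuous continuous_on_compose2[OF cont(2)] continuous_intros) auto
      show "continuous_on (?U \<times> cbox 0 h) (\<lambda>(\<sigma>, \<tau>). dird v (dird w f) (x + \<sigma> *\<^sub>R v + \<tau> *\<^sub>R w))"
        unfolding split_beta using inS h
        by (intro continuous_on_compose2[OF cont(1)] continuous_intros) auto
    qed (use d in auto)
    have FT: "integral (cbox 0 h) (\<lambda>\<tau>. dird w f (x + \<sigma> *\<^sub>R v + \<tau> *\<^sub>R w))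
        = f (x + \<sigma> *\<^sub>R v + h *\<^sub>R w) - f (x + \<sigma> *\<^sub>R v)" if "\<sigma> \<in> ?U" for \<sigma>
    proof -
      have "((\<lambda>\<tau>. dird w f (x + \<sigma> *\<^sub>R v + \<tau> *\<^sub>R w)) has_integral
         f (x + \<sigma> *\<^sub>R v + h *\<^sub>R w) - f (x + \<sigma> *\<^sub>R v + 0 *\<^sub>R w)) {0..h}"
        using inS[of \<sigma>] that h
        by (intro fundamental_theorem_of_calculus smooth_on_vector_derivative_line[of S] assms) auto
      then show ?thesis by (auto simp: integral_unique)
    qed
    have 1: "((\<lambda>\<sigma>. f (x + \<sigma> *\<^sub>R v + h *\<^sub>R w) - f (x + \<sigma> *\<^sub>R v)) has_vector_derivative
      integral {0..h} (\<lambda>\<tau>. dird v (dird w f) (x + \<tau> *\<^sub>R w))) (at 0 within ?U)"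
      using FT d by (intro has_vector_derivative_transform[OF _ _ L[simplified]]) auto
    have "((\<lambda>\<sigma>. f ((x + h *\<^sub>R w) + \<sigma> *\<^sub>R v) - f (x + \<sigma> *\<^sub>R v)) has_vector_derivative
        dird v f ((x + h *\<^sub>R w) + 0 *\<^sub>R v) - dird v f (x + 0 *\<^sub>R v)) (at 0 within ?U)"
      using inS[of 0 h] h d
      by (intro has_vector_derivative_diff smooth_on_vector_derivative_line[of S] assms)
        (auto simp: assms(3))
    then have 2: "((\<lambda>\<sigma>. f (x + \<sigma> *\<^sub>R v + h *\<^sub>R w) - f (x + \<sigma> *\<^sub>R v)) has_vector_derivative
        dird v f (x + h *\<^sub>R w) - dird v f x) (at 0 within ?U)"
      by (simp add: add_ac)
    show ?thesis
      using vector_derivative_unique_within[OF _ 2 1] d by (simp add: trivial_limit_within)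
  qed
  have "((\<lambda>h. integral {0..h} (\<lambda>\<tau>. dird v (dird w f) (x + \<tau> *\<^sub>R w))) has_vector_derivative
      dird v (dird w f) (x + 0 *\<^sub>R w)) (at 0 within {0..d})"
    using inS[of 0] d
    by (intro integral_has_vector_derivative continuous_on_compose2[OF cont(1)] continuous_intros) auto
  then have 1: "((\<lambda>h. dird v f (x + h *\<^sub>R w) - dird v f x) has_vector_derivative
      dird v (dird w f) (x + 0 *\<^sub>R w)) (at 0 within {0..d})"
    by (rule has_vector_derivative_transform[rotated 2]) (use d key in auto)
  have 2: "((\<lambda>h. dird v f (x + h *\<^sub>R w) - dird v f x) has_vector_derivative
      dird w (dird v f) (x + 0 *\<^sub>R w) - 0) (at 0 within {0..d})"
    by (intro has_vector_derivative_diff smooth_on_vector_derivative_line[of S] smooth_on_dird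
        has_vector_derivative_const assms) (simp add: assms(3))
  show ?thesis
    using vector_derivative_unique_within[OF _ 1 2] d by (simp add: trivial_limit_within)
qed

section \<open>Integration on the torus\<close>

lemma doubly_periodicD:
  assumes "doubly_periodic f"
  shows "f (x + (2 * pi, 0)) = f x" "f (x + (0, 2 * pi)) = f x"
    "f (2 * pi, y) = f (0, y)" "f (z, 2 * pi) = f (z, 0)"
proof -
  show "f (x + (2 * pi, 0)) = f x" "f (x + (0, 2 * pi)) = f x"
    using assms unfolding doubly_periodic_def by blast+
  have "f ((0, y) + (2 * pi, 0)) = f (0, y)" "f ((z, 0) + (0, 2 * pi)) = f (z, 0)"
    using assms unfolding doubly_periodic_def by blast+
  then show "f (2 * pi, y) = f (0, y)" "f (z, 2 * pi) = f (z, 0)" by simp_all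
qed

lemma doubly_periodic_eq_0:
  fixes f :: "real \<times> real \<Rightarrow> 'a::zero"
  assumes f: "doubly_periodic f" and zero: "\<And>x. x \<in> cbox (0, 0) (2 * pi, 2 * pi) \<Longrightarrow> f x = 0"
  shows "f x = 0"
proof -
  have nat1: "f (a + 2 * pi * real n, b) = f (a, b)" "f (a, b + 2 * pi * real n) = f (a, b)" for a b n
  proof (induction n)
    case (Suc n)
    {
      case 1
      then show ?case using doubly_periodicD(1)[OF f, of "(a + 2 * pi * real n, b)"] Suc
        by (simp add: algebra_simps)
    next
      case 2
      then show ?case using doubly_periodicD(2)[OF f, of "(a, b + 2 * pi * real n)"] Suc
        by (simp add: algebra_simps)
    }
  qed simp_all
  have int1: "f (a + 2 * pi * of_int k, b) = f (a, b)" "f (a, b + 2 * pi * of_int k) = f (a, b)" for a b k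
  proof -
    \<comment> \<open>For negative \<open>k\<close> the natural-number case is applied at the
      shifted point, from which \<open>- k\<close> periods lead back to \<open>a\<close>.\<close>
    show "f (a + 2 * pi * of_int k, b) = f (a, b)"
      using nat1(1)[where a=a and n="nat k" and b=b]
        nat1(1)[where a="a + 2 * pi * of_int k" and n="nat (- k)" and b=b]
      by (cases "k \<ge> 0") simp_all
    show "f (a, b + 2 * pi * of_int k) = f (a, b)"
      using nat1(2)[where b=b and n="nat k" and a=a]
        nat1(2)[where b="b + 2 * pi * of_int k" and n="nat (- k)" and a=a]
      by (cases "k \<ge> 0") simp_all
  qed
  \<comment> \<open>Reduction modulo a period: \<open>r a\<close> is \<open>2 * pi\<close> times the
    fractional part of \<open>a / (2 * pi)\<close>.\<close>
  define r where "r a = a + 2 * pi * of_int (- \<lfloor>a / (2 * pi)\<rfloor>)" for a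
  have r: "0 \<le> r a" "r a \<le> 2 * pi" for a
  proof -
    have "r a = 2 * pi * frac (a / (2 * pi))" by (simp add: r_def frac_def algebra_simps)
    then show "0 \<le> r a" "r a \<le> 2 * pi"
      using frac_ge_0[of "a / (2 * pi)"] frac_lt_1[of "a / (2 * pi)"] by (simp_all add: mult_left_le)
  qed
  have "f (fst x, snd x) = f (r (fst x), r (snd x))"
    unfolding r_def int1 ..
  also have "\<dots> = 0" using r by (intro zero) (simp add: cbox_Pair_eq)
  finally show ?thesis by simp
qed

lemma torus_integral_eq:
  "torus_integral f = integral (cbox (0, 0) (2 * pi, 2 * pi)) f / 4"
  unfolding torus_integral_def by simp

lemma torus_integrable:
  fixes f :: "real \<times> real \<Rightarrow> real"
  shows "continuous_on UNIV f \<Longrightarrow> f integrable_on cbox (0, 0) (2 * pi, 2 * pi)"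
  by (intro integrable_continuous) (rule continuous_on_subset[OF _ subset_UNIV])

lemma torus_integral_add:
  "continuous_on UNIV f \<Longrightarrow> continuous_on UNIV g \<Longrightarrow>
    torus_integral (\<lambda>x. f x + g x) = torus_integral f + torus_integral g"
  by (simp add: torus_integral_eq integral_add torus_integrable add_divide_distrib)

lemma torus_integral_diff:
  "continuous_on UNIV f \<Longrightarrow> continuous_on UNIV g \<Longrightarrow>
    torus_integral (\<lambda>x. f x - g x) = torus_integral f - torus_integral g"
  by (simp add: torus_integral_eq integral_diff torus_integrable diff_divide_distrib)

lemma torus_integral_mult: "torus_integral (\<lambda>x. c * f x) = c * torus_integral f"
  by (simp add: torus_integral_eq)

lemma torus_integral_minus: "torus_integral (\<lambda>x. - f x) = - torus_integral f"
  using torus_integral_mult[of "-1" f] by simp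

text \<open>A continuous nonnegative function with integral zero vanishes on a box with nonempty
  interior; periodicity carries this to the whole plane.\<close>

lemma torus_integral_square_eq_0:
  fixes f :: "real \<times> real \<Rightarrow> 'n::euclidean_space"
  assumes "continuous_on UNIV f" "doubly_periodic f" "torus_integral (\<lambda>x. f x \<bullet> f x) = 0"
  shows "f x = 0"
proof (rule doubly_periodic_eq_0[OF assms(2)])
  fix x :: "real \<times> real" assume x: "x \<in> cbox (0, 0) (2 * pi, 2 * pi)"
  have "box (0::real, 0::real) (2 * pi, 2 * pi) \<noteq> {}"
    by (auto simp: box_ne_empty Basis_prod_def)
  moreover have "continuous_on (cbox (0, 0) (2 * pi, 2 * pi)) (\<lambda>x. f x \<bullet> f x)"
    by (intro continuous_intros continuous_on_subset[OF assms(1) subset_UNIV])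
  ultimately show "f x = 0"
    using assms(3) x by (subst (asm) torus_integral_eq) (simp add: integral_cbox_eq_0_iff)
qed

lemma dird_inner:
  fixes f g :: "'a::real_normed_vector \<Rightarrow> 'b::real_inner"
  assumes "smooth_on S f" "smooth_on S g" "x \<in> S"
  shows "dird v (\<lambda>x. f x \<bullet> g x) x = f x \<bullet> dird v g x + dird v f x \<bullet> g x"
  by (rule dird_eqI) (rule has_derivative_inner[OF smooth_on_has_derivative smooth_on_has_derivative]; fact)

lemma dird_add:
  assumes "smooth_on S f" "smooth_on S g" "x \<in> S"
  shows "dird v (\<lambda>x. f x + g x) x = dird v f x + dird v g x"
  by (rule dird_eqI) (rule has_derivative_add[OF smooth_on_has_derivative smooth_on_has_derivative]; fact)

lemma dird_cmul:
  assumes "smooth_on S f" "x \<in> S"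
  shows "dird v (\<lambda>x. c *\<^sub>R f x) x = c *\<^sub>R dird v f x"
  by (rule dird_eqI) (rule has_derivative_scaleR_right[OF smooth_on_has_derivative]; fact)

text \<open>Stated for any translation-invariant open set, so that it covers both functions on the
  plane and the parameter domain of a variation.\<close>

lemma dird_periodic:
  assumes "open S" "smooth_on S f" "\<And>z. z \<in> S \<Longrightarrow> z + q \<in> S \<and> f (z + q) = f z" "z \<in> S"
  shows "dird v f (z + q) = dird v f z"
proof -
  have "((\<lambda>z. f (z + q)) has_derivative (\<lambda>v. dird v f (z + q))) (at z)"
    by (rule has_derivative_compose[of "\<lambda>z. z + q", OF _ smooth_on_has_derivative[OF assms(2)]])
      (use assms(3)[OF assms(4)] in \<open>auto intro!: derivative_eq_intros\<close>)
  then have "dird v (\<lambda>z. f (z + q)) z = dird v f (z + q)" by (rule dird_eqI)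
  moreover have "dird v (\<lambda>z. f (z + q)) z = dird v f z"
    by (rule dird_cong_open[OF assms(1,4)]) (use assms(3) in blast)
  ultimately show ?thesis by simp
qed

lemma doubly_periodic_dird:
  "smooth_on UNIV f \<Longrightarrow> doubly_periodic f \<Longrightarrow> doubly_periodic (dird v f)"
  unfolding doubly_periodic_def by (metis UNIV_I dird_periodic open_UNIV)

text \<open>The divergence theorem on a closed surface: along each coordinate line the fundamental
  theorem leaves a boundary difference, which is zero by periodicity.\<close>

lemma torus_integral_dird:
  fixes h :: "real \<times> real \<Rightarrow> real"
  assumes h: "smooth_on UNIV h" "doubly_periodic h"
  shows "torus_integral (dird v h) = 0"
proof -
  have cont: "continuous_on UNIV (dird w h)" for w
    using h by (auto intro: smooth_on_imp_continuous_on smooth_on_dird)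
  have slice: "((\<lambda>y. dird w h (x, y)) has_integral h (x, 2 * pi) - h (x, 0)) {0..2 * pi}"
    if w: "w = (0, 1)" for x w
  proof (rule fundamental_theorem_of_calculus)
    show "((\<lambda>y. h (x, y)) has_vector_derivative dird w h (x, y)) (at y within {0..2 * pi})" for y
      using smooth_on_vector_derivative_line[OF h(1), of "(x, 0)" y w] w by simp
  qed simp
  have slice': "((\<lambda>x. dird w h (x, y)) has_integral h (2 * pi, y) - h (0, y)) {0..2 * pi}"
    if w: "w = (1, 0)" for y w
  proof (rule fundamental_theorem_of_calculus)
    show "((\<lambda>x. h (x, y)) has_vector_derivative dird w h (x, y)) (at x within {0..2 * pi})" for x
      using smooth_on_vector_derivative_line[OF h(1), of "(0, y)" x w] w by simp
  qed simp
  have 1: "torus_integral (dird (0, 1) h) = 0"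
    unfolding torus_integral_eq
    by (subst integral_prod_continuous)
      (use slice[OF refl, THEN integral_unique] in \<open>auto simp: continuous_on_subset[OF cont subset_UNIV] doubly_periodicD(3,4)[OF h(2)]\<close>)
  have "continuous_on (cbox (0, 0) (2 * pi, 2 * pi)) (\<lambda>(x, y). dird (1, 0) h (x, y))"
    by (simp add: continuous_on_subset[OF cont subset_UNIV])
  from integral_swap_continuous[OF this] have 2: "torus_integral (dird (1, 0) h) = 0"
    unfolding torus_integral_eq
    by (subst integral_prod_continuous)
      (use slice'[OF refl, THEN integral_unique] in \<open>auto simp: continuous_on_subset[OF cont subset_UNIV] doubly_periodicD(3,4)[OF h(2)]\<close>)
  \<comment> \<open>Linearity in the direction reduces \<open>v\<close> to the two coordinate
    directions.\<close>
  have "dird v h x = fst v * dird (1, 0) h x + snd v * dird (0, 1) h x" for x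
  proof -
    have l: "linear (\<lambda>v. dird v h x)"
      by (rule has_derivative_linear[OF smooth_on_has_derivative[OF h(1)]]) simp
    have "v = fst v *\<^sub>R (1, 0) + snd v *\<^sub>R (0, 1)" by (simp add: prod_eq_iff)
    then show ?thesis using linear_add[OF l] linear_cmul[OF l] by (metis real_scaleR_def)
  qed
  then have "dird v h = (\<lambda>x. fst v * dird (1, 0) h x + snd v * dird (0, 1) h x)" by blast
  then show ?thesis
    using 1 2 by (simp add: torus_integral_add torus_integral_mult continuous_on_mult_left cont)
qed

text \<open>The metric is flat and the frame constant, so no connection terms appear. The sign is
  that of the trace of the Hessian, opposite to the rough Laplacian.\<close>

definition lap :: "(real \<times> real \<Rightarrow> 'n::euclidean_space) \<Rightarrow> real \<times> real \<Rightarrow> 'n" where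
  "lap f x = (\<Sum>e\<in>torus_frame. dird e (dird e f) x)"

lemma smooth_on_lap: "smooth_on UNIV f \<Longrightarrow> smooth_on UNIV (lap f)"
  unfolding lap_def[abs_def] by (intro smooth_intros) auto

lemma doubly_periodic_lap:
  "smooth_on UNIV f \<Longrightarrow> doubly_periodic f \<Longrightarrow> doubly_periodic (lap f)"
  using doubly_periodic_dird[OF smooth_on_dird doubly_periodic_dird, of f]
  unfolding lap_def[abs_def] doubly_periodic_def by simp

text \<open>Green's formula: for each \<open>e\<close> the integral of the derivative of
  \<open>dird e f x \<bullet> g x\<close> along \<open>e\<close> vanishes.\<close>

lemma torus_integral_Dirichlet:
  fixes f g :: "real \<times> real \<Rightarrow> 'n::euclidean_space"
  assumes f: "smooth_on UNIV f" "doubly_periodic f" and g: "smooth_on UNIV g" "doubly_periodic g"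
  shows "torus_integral (\<lambda>x. \<Sum>e\<in>torus_frame. dird e f x \<bullet> dird e g x)
    = - torus_integral (\<lambda>x. lap f x \<bullet> g x)"
proof -
  have z: "torus_integral (\<lambda>x. dird e f x \<bullet> dird e g x + dird e (dird e f) x \<bullet> g x) = 0" for e
  proof -
    have "doubly_periodic (\<lambda>x. dird e f x \<bullet> g x)"
      using doubly_periodic_dird[OF f, of e] g(2) by (simp add: doubly_periodic_def)
    then have "torus_integral (dird e (\<lambda>x. dird e f x \<bullet> g x)) = 0"
      by (intro torus_integral_dird smooth_intros f g open_UNIV)
    moreover have "dird e (\<lambda>x. dird e f x \<bullet> g x) = (\<lambda>x. dird e f x \<bullet> dird e g x + dird e (dird e f) x \<bullet> g x)"
      by (rule ext, rule dird_inner[of UNIV]) (auto intro: smooth_on_dird f g)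
    ultimately show ?thesis by simp
  qed
  have c: "continuous_on UNIV (\<lambda>x. dird e f x \<bullet> dird e g x)"
    "continuous_on UNIV (\<lambda>x. dird e (dird e f) x \<bullet> g x)" for e
    by (intro smooth_on_imp_continuous_on smooth_intros f g open_UNIV)+
  show ?thesis
    using z[of "(2, 0)"] z[of "(0, 2)"]
    by (simp add: lap_def torus_frame_def inner_add_left torus_integral_add continuous_on_add c)
qed

text \<open>The direction \<open>(\<alpha>, \<beta>)\<close> lets one statement serve both
  parameters; the base point is arbitrary because the outer derivative needs the inner one at every
  nearby \<open>t\<close>.\<close>

lemma torus_integral_leibniz:
  fixes G :: "real \<times> real \<times> real \<times> real \<Rightarrow> real"
  assumes G: "smooth_on ({-\<epsilon><..<\<epsilon>} \<times> {-\<epsilon><..<\<epsilon>} \<times> UNIV) G"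
    and ts: "t \<in> {-\<epsilon><..<\<epsilon>}" "s \<in> {-\<epsilon><..<\<epsilon>}"
  shows "((\<lambda>\<tau>. torus_integral (\<lambda>x. G (t + \<tau> * \<alpha>, s + \<tau> * \<beta>, x))) has_real_derivative
    torus_integral (\<lambda>x. dird (\<alpha>, \<beta>, 0) G (t, s, x))) (at 0)"
proof -
  let ?O = "{-\<epsilon><..<\<epsilon>} \<times> {-\<epsilon><..<\<epsilon>} \<times> (UNIV :: (real \<times> real) set)"
  let ?p = "\<lambda>\<tau>. (t + \<tau> * \<alpha>, s + \<tau> * \<beta>)"
  have "open (?p -` ({-\<epsilon><..<\<epsilon>} \<times> {-\<epsilon><..<\<epsilon>}))"
    by (rule open_vimage) (intro open_Times open_greaterThanLessThan continuous_intros)+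
  moreover have "0 \<in> ?p -` ({-\<epsilon><..<\<epsilon>} \<times> {-\<epsilon><..<\<epsilon>})" using ts by simp
  ultimately obtain d where d: "d > 0" "ball 0 d \<subseteq> ?p -` ({-\<epsilon><..<\<epsilon>} \<times> {-\<epsilon><..<\<epsilon>})"
    by (rule openE)
  let ?U = "ball (0::real) d"
  have in_O: "(t + \<tau> * \<alpha>, s + \<tau> * \<beta>, x) \<in> ?O" if "\<tau> \<in> ?U" for \<tau> x
    using subsetD[OF d(2) that] by simp
  have cont: "continuous_on ?O G" "continuous_on ?O (dird v G)" for v
    by (intro smooth_on_imp_continuous_on smooth_on_dird G)+
  have "((\<lambda>\<tau>. integral (cbox (0,0) (2 * pi, 2 * pi)) (\<lambda>x. G (t + \<tau> * \<alpha>, s + \<tau> * \<beta>, x))) has_real_derivative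
    integral (cbox (0,0) (2 * pi, 2 * pi)) (\<lambda>x. dird (\<alpha>, \<beta>, 0) G (t + 0 * \<alpha>, s + 0 * \<beta>, x))) (at 0 within ?U)"
  proof (rule leibniz_rule_field_derivative)
    show "((\<lambda>\<tau>. G (t + \<tau> * \<alpha>, s + \<tau> * \<beta>, x)) has_real_derivative
        dird (\<alpha>, \<beta>, 0) G (t + \<tau> * \<alpha>, s + \<tau> * \<beta>, x)) (at \<tau> within ?U)" if "\<tau> \<in> ?U" for \<tau> x
      using smooth_on_vector_derivative_line[OF G, of "(t, s, x)" \<tau> "(\<alpha>, \<beta>, 0)" ?U] in_O[OF that]
      by (simp add: has_real_derivative_iff_has_vector_derivative)
    show "(\<lambda>x. G (t + \<tau> * \<alpha>, s + \<tau> * \<beta>, x)) integrable_on cbox (0, 0) (2 * pi, 2 * pi)" if "\<tau> \<in> ?U" for \<tau>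
      by (intro integrable_continuous continuous_on_compose2[OF cont(1)] continuous_intros image_subsetI in_O that)
    show "continuous_on (?U \<times> cbox (0, 0) (2 * pi, 2 * pi))
        (\<lambda>(\<tau>, x). dird (\<alpha>, \<beta>, 0) G (t + \<tau> * \<alpha>, s + \<tau> * \<beta>, x))"
      unfolding split_beta
      by (intro continuous_on_compose2[OF cont(2)] continuous_intros image_subsetI in_O) auto
  qed (use d in auto)
  moreover have "at 0 within ?U = at 0" by (rule at_within_open) (use d in auto)
  ultimately have "((\<lambda>\<tau>. integral (cbox (0,0) (2 * pi, 2 * pi)) (\<lambda>x. G (t + \<tau> * \<alpha>, s + \<tau> * \<beta>, x))) has_real_derivative
    integral (cbox (0,0) (2 * pi, 2 * pi)) (\<lambda>x. dird (\<alpha>, \<beta>, 0) G (t, s, x))) (at 0)"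
    by simp
  from DERIV_cdivide[OF this, of 4] show ?thesis by (simp add: torus_integral_eq)
qed

section \<open>The second variation of the energy\<close>

lemma sectionsD:
  assumes "V \<in> sections u"
  shows "smooth_on UNIV V" "doubly_periodic V" "V x \<bullet> u x = 0"
  using assms unfolding sections_def by blast+

lemma sectionsI:
  "smooth_on UNIV V \<Longrightarrow> doubly_periodic V \<Longrightarrow> (\<And>x. V x \<bullet> u x = 0) \<Longrightarrow> V \<in> sections u"
  unfolding sections_def by blast

lemma torus_sphere_mapD:
  assumes "torus_sphere_map R u"
  shows "smooth_on UNIV u" "doubly_periodic u" "u x \<bullet> u x = R\<^sup>2"
proof -
  show "smooth_on UNIV u" "doubly_periodic u"
    using assms unfolding torus_sphere_map_def by blast+
  have "u x \<in> sphere 0 R" using assms unfolding torus_sphere_map_def by blast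
  then show "u x \<bullet> u x = R\<^sup>2" by (simp flip: power2_norm_eq_inner)
qed

text \<open>With \<open>A\<close> the mixed second derivative of the variation, the Hessian
  integrates the pairing of the differentials of \<open>V\<close> and \<open>W\<close> plus that of
  \<open>u\<close> and \<open>A\<close>. By Green's formula the second part is
  \<open>\<kappa>\<close> times the integral of \<open>u x \<bullet> A x\<close>, and
  differentiating the sphere constraint twice gives
  \<open>u x \<bullet> A x = - (V x \<bullet> W x)\<close>.\<close>

lemma second_variation_energy:
  fixes u :: "real \<times> real \<Rightarrow> 'n::euclidean_space"
  assumes u: "torus_sphere_map R u" and lap_u: "\<And>x. lap u x = - \<kappa> *\<^sub>R u x"
    and \<Phi>: "variation2 R u \<Phi>"
  defines "V \<equiv> \<lambda>x. vector_derivative (\<lambda>t. \<Phi> t 0 x) (at 0)"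
    and "W \<equiv> \<lambda>x. vector_derivative (\<lambda>s. \<Phi> 0 s x) (at 0)"
  shows "deriv (\<lambda>t. deriv (\<lambda>s. energy (\<Phi> t s)) 0) 0
      = torus_integral (\<lambda>x. (- lap V x - \<kappa> *\<^sub>R V x) \<bullet> W x)" (is ?hessian)
    and "\<And>x. W x \<bullet> u x = 0"
proof -
  define F where "F = (\<lambda>(t, s, x). \<Phi> t s x)"
  obtain \<epsilon> where \<epsilon>: "\<epsilon> > 0" "smooth_on ({-\<epsilon><..<\<epsilon>} \<times> {-\<epsilon><..<\<epsilon>} \<times> UNIV) F"
    and map: "\<And>t s. t \<in> {-\<epsilon><..<\<epsilon>} \<Longrightarrow> s \<in> {-\<epsilon><..<\<epsilon>} \<Longrightarrow> torus_sphere_map R (\<Phi> t s)"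
    using \<Phi> unfolding variation2_def F_def by blast
  define S :: "(real \<times> real \<times> real \<times> real) set" where "S = {-\<epsilon><..<\<epsilon>} \<times> {-\<epsilon><..<\<epsilon>} \<times> UNIV"
  have S: "open S" unfolding S_def by (intro open_Times open_greaterThanLessThan open_UNIV)
  have F: "smooth_on S F" using \<epsilon>(2) by (simp add: S_def)
  have zero_S: "(0, 0, x) \<in> S" for x using \<epsilon>(1) by (simp add: S_def)
  let ?s = "(0, 1, 0) :: real \<times> real \<times> real \<times> real"
  let ?t = "(1, 0, 0) :: real \<times> real \<times> real \<times> real"
  have \<Phi>0: "\<Phi> 0 0 = u" using \<Phi> by (simp add: variation2_def)
  have F0: "F (0, 0, x) = u x" for x by (simp add: F_def \<Phi>0)
  have slice: "smooth_on UNIV (\<lambda>x. H (0, 0, x))" if "smooth_on S H" for H :: "_ \<Rightarrow> 'n"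
    by (rule smooth_on_compose_linear[OF open_UNIV S _ _ that])
      (auto intro!: bounded_linear_Pair bounded_linear_zero bounded_linear_ident simp: zero_S)
  have slice_dird: "dird e (\<lambda>x. H (t, s, x)) x = dird (0, 0, e) H (t, s, x)"
    if "smooth_on S H" "(t, s, x) \<in> S" for H :: "_ \<Rightarrow> 'n" and t s e x
  proof -
    have "((\<lambda>x. H (t, s, x)) has_derivative (\<lambda>e. dird (0, 0, e) H (t, s, x))) (at x)"
      by (rule has_derivative_compose[of "\<lambda>x. (t, s, x)", OF _ smooth_on_has_derivative[OF that]])
        (auto intro!: derivative_eq_intros simp: zero_prod_def)
    then show ?thesis by (rule dird_eqI)
  qed
  have V: "V x = dird ?t F (0, 0, x)" for x
    using smooth_on_vector_derivative_line[OF F, of "(0, 0, x)" 0 ?t UNIV] zero_S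
    by (simp add: V_def F_def vector_derivative_at)
  have W: "W x = dird ?s F (0, 0, x)" for x
    using smooth_on_vector_derivative_line[OF F, of "(0, 0, x)" 0 ?s UNIV] zero_S
    by (simp add: W_def F_def vector_derivative_at)
  \<comment> \<open>The acceleration of the variation. It need not be tangent to the sphere, and its
    component along \<open>u\<close> produces the zeroth-order term.\<close>
  define A where "A x = dird ?t (dird ?s F) (0, 0, x)" for x
  have per: "dird v H ((t, s, x) + (0, 0, q)) = dird v H (t, s, x)"
    if "smooth_on S H" "(t, s, x) \<in> S" "\<And>z. z \<in> S \<Longrightarrow> H (z + (0, 0, q)) = H z"
    for H :: "_ \<Rightarrow> 'n" and v t s x q
    by (rule dird_periodic[OF S that(1) _ that(2)]) (auto simp: that(3), auto simp: S_def)
  have Fper: "F (z + (0, 0, q)) = F z" if "z \<in> S" "q \<in> {(2 * pi, 0), (0, 2 * pi)}" for z q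
    using map[of "fst z" "fst (snd z)"] that
    by (cases z) (auto simp: S_def F_def torus_sphere_map_def doubly_periodic_def)
  have smoothV: "smooth_on UNIV V" and smoothW: "smooth_on UNIV W" and smoothA: "smooth_on UNIV A"
    unfolding V[abs_def] W[abs_def] A_def[abs_def] by (intro slice smooth_on_dird F)+
  have dper: "dird v F (z + (0, 0, q)) = dird v F z" if "z \<in> S" "q \<in> {(2 * pi, 0), (0, 2 * pi)}" for v z q
    using per[OF F, of "fst z" "fst (snd z)" "snd (snd z)" q v] Fper that by simp
  have ddper: "dird w (dird v F) (z + (0, 0, q)) = dird w (dird v F) z"
    if "z \<in> S" "q \<in> {(2 * pi, 0), (0, 2 * pi)}" for v w z q
    using per[OF smooth_on_dird[OF F], of "fst z" "fst (snd z)" "snd (snd z)" v q w] dper that by simp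
  have dpV: "doubly_periodic V" and dpW: "doubly_periodic W" and dpA: "doubly_periodic A"
    using dper[OF zero_S] ddper[OF zero_S] unfolding V[abs_def] W[abs_def] A_def[abs_def] doubly_periodic_def by simp_all
  have norm_F: "F z \<bullet> F z = R\<^sup>2" if "z \<in> S" for z
    using map[of "fst z" "fst (snd z)"] that
    by (cases z) (auto simp: S_def F_def torus_sphere_map_def simp flip: power2_norm_eq_inner)
  have const: "dird v (\<lambda>_. c :: real) z = 0" for v c and z :: "real \<times> real \<times> real \<times> real"
    by (rule dird_eqI) simp
  have orth: "F z \<bullet> dird v F z = 0" if "z \<in> S" for v z
  proof -
    have "dird v (\<lambda>z. F z \<bullet> F z) z = dird v (\<lambda>_. R\<^sup>2) z"
      using S that norm_F by (rule dird_cong_open)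
    then show ?thesis
      using dird_inner[OF F F that, of v] by (simp add: const inner_commute)
  qed
  \<comment> \<open>The orthogonality \<open>orth\<close> in direction \<open>?s\<close>,
    differentiated once more in direction \<open>?t\<close>.\<close>
  have orth2: "dird ?t F z \<bullet> dird ?s F z = - (F z \<bullet> dird ?t (dird ?s F) z)" if "z \<in> S" for z
  proof -
    have "dird ?t (\<lambda>z. F z \<bullet> dird ?s F z) z = dird ?t (\<lambda>_. 0) z"
      using S that orth by (rule dird_cong_open)
    then show ?thesis
      using dird_inner[OF F smooth_on_dird[OF F] that, of ?t ?s] by (simp add: const)
  qed
  show "W x \<bullet> u x = 0" for x
    using orth[OF zero_S, of x ?s] by (simp add: W F0 inner_commute)
  have uA: "u x \<bullet> A x = - (V x \<bullet> W x)" for x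
    using orth2[OF zero_S, of x] by (simp add: V W A_def F0)

  \<comment> \<open>Spatial derivatives are taken on the full parameter domain, so that
    \<open>dird_commute\<close> can exchange them with the parameter derivatives.\<close>
  define D where "D e = dird (0, 0, e) F" for e
  have D: "smooth_on S (D e)" for e unfolding D_def by (intro smooth_on_dird F)
  define G where "G z = (\<Sum>e\<in>torus_frame. 1 / 2 * (D e z \<bullet> D e z))" for z
  have G: "smooth_on S G"
    unfolding G_def[abs_def] by (intro smooth_intros S D)
  have energy: "energy (\<Phi> t s) = torus_integral (\<lambda>x. G (t, s, x))"
    if "t \<in> {-\<epsilon><..<\<epsilon>}" "s \<in> {-\<epsilon><..<\<epsilon>}" for t s
  proof -
    have "frechet_derivative (\<Phi> t s) (at x) e = D e (t, s, x)" for x e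
      using slice_dird[OF F, of t s x e] that by (simp add: F_def S_def D_def dird_def)
    then show ?thesis
      unfolding energy_def G_def power2_norm_eq_inner sum_distrib_left[symmetric] torus_integral_mult by simp
  qed
  have G1: "dird v G z = (\<Sum>e\<in>torus_frame. D e z \<bullet> dird v (D e) z)" if "z \<in> S" for v z
    unfolding G_def[abs_def]
    by (rule dird_eqI)
      (auto intro!: derivative_eq_intros smooth_on_has_derivative[OF D that] sum.cong simp: inner_commute)
  have G2: "dird ?t (dird ?s G) (0, 0, x)
      = (\<Sum>e\<in>torus_frame. dird e V x \<bullet> dird e W x) + (\<Sum>e\<in>torus_frame. dird e u x \<bullet> dird e A x)" for x
  proof -
    let ?z = "(0, 0, x) :: real \<times> real \<times> real \<times> real"
    have comm: "dird v (D e) z = dird (0, 0, e) (dird v F) z" if "z \<in> S" for v e z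
      unfolding D_def by (rule dird_commute[OF S F that])
    have 1: "dird ?t (D e) ?z = dird e V x" "dird ?s (D e) ?z = dird e W x" for e
      using slice_dird[OF smooth_on_dird[OF F] zero_S, of e] by (simp_all add: comm zero_S V[abs_def] W[abs_def])
    have 2: "dird ?t (dird ?s (D e)) ?z = dird e A x" for e
    proof -
      have "dird ?t (dird ?s (D e)) ?z = dird ?t (dird (0, 0, e) (dird ?s F)) ?z"
        by (rule dird_cong_open[OF S zero_S comm])
      also have "\<dots> = dird (0, 0, e) (dird ?t (dird ?s F)) ?z"
        by (rule dird_commute[OF S smooth_on_dird[OF F] zero_S])
      also have "\<dots> = dird e A x"
        unfolding A_def[abs_def] by (rule slice_dird[OF smooth_on_dird[OF smooth_on_dird[OF F]] zero_S, symmetric])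
      finally show ?thesis .
    qed
    have 3: "D e ?z = dird e u x" for e
      using slice_dird[OF F zero_S, of e] by (simp add: D_def F0)
    have "dird ?t (dird ?s G) ?z = dird ?t (\<lambda>z. \<Sum>e\<in>torus_frame. D e z \<bullet> dird ?s (D e) z) ?z"
      by (rule dird_cong_open[OF S zero_S G1])
    also have "\<dots> = (\<Sum>e\<in>torus_frame. D e ?z \<bullet> dird ?t (dird ?s (D e)) ?z + dird ?t (D e) ?z \<bullet> dird ?s (D e) ?z)"
      by (rule dird_eqI) (intro has_derivative_sum has_derivative_inner smooth_on_has_derivative[OF D zero_S]
          smooth_on_has_derivative[OF smooth_on_dird[OF D] zero_S])
    finally show ?thesis by (simp add: 1 2 3 sum.distrib add.commute)
  qed
  \<comment> \<open>Required for all \<open>t\<close> near \<open>0\<close>, since the outer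
    \<open>deriv\<close> differentiates this expression in \<open>t\<close>.\<close>
  have d1: "deriv (\<lambda>s. energy (\<Phi> t s)) 0 = torus_integral (\<lambda>x. dird ?s G (t, 0, x))"
    if t: "t \<in> {-\<epsilon><..<\<epsilon>}" for t
  proof (rule DERIV_imp_deriv)
    have "((\<lambda>s. torus_integral (\<lambda>x. G (t, s, x))) has_real_derivative torus_integral (\<lambda>x. dird ?s G (t, 0, x))) (at 0)"
      using torus_integral_leibniz[OF G[unfolded S_def] t, where s=0 and \<alpha>=0 and \<beta>=1] \<epsilon>(1) by simp
    then show "((\<lambda>s. energy (\<Phi> t s)) has_real_derivative torus_integral (\<lambda>x. dird ?s G (t, 0, x))) (at 0)"
      by (rule has_field_derivative_transform_within_open[of _ _ _ "{-\<epsilon><..<\<epsilon>}"])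
        (use \<epsilon>(1) energy[OF t] in auto)
  qed
  have "deriv (\<lambda>t. deriv (\<lambda>s. energy (\<Phi> t s)) 0) 0 = torus_integral (\<lambda>x. dird ?t (dird ?s G) (0, 0, x))"
  proof (rule DERIV_imp_deriv)
    have "((\<lambda>t. torus_integral (\<lambda>x. dird ?s G (t, 0, x))) has_real_derivative torus_integral (\<lambda>x. dird ?t (dird ?s G) (0, 0, x))) (at 0)"
      using torus_integral_leibniz[OF smooth_on_dird[OF G, unfolded S_def], where t=0 and s=0 and \<alpha>=1 and \<beta>=0] \<epsilon>(1) by simp
    then show "((\<lambda>t. deriv (\<lambda>s. energy (\<Phi> t s)) 0) has_real_derivative torus_integral (\<lambda>x. dird ?t (dird ?s G) (0, 0, x))) (at 0)"
      by (rule has_field_derivative_transform_within_open[of _ _ _ "{-\<epsilon><..<\<epsilon>}"])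
        (use \<epsilon>(1) d1 in auto)
  qed
  also have "\<dots> = torus_integral (\<lambda>x. \<Sum>e\<in>torus_frame. dird e V x \<bullet> dird e W x)
      + torus_integral (\<lambda>x. \<Sum>e\<in>torus_frame. dird e u x \<bullet> dird e A x)"
    unfolding G2
    by (intro torus_integral_add smooth_on_imp_continuous_on smooth_intros open_UNIV smoothV smoothW smoothA)
      (use u in \<open>simp add: torus_sphere_map_def\<close>)
  also have "\<dots> = - torus_integral (\<lambda>x. lap V x \<bullet> W x) - torus_integral (\<lambda>x. lap u x \<bullet> A x)"
    using u by (simp add: torus_integral_Dirichlet smoothV dpV smoothW dpW smoothA dpA torus_sphere_map_def)
  also have "\<dots> = torus_integral (\<lambda>x. - (lap V x \<bullet> W x) - \<kappa> * (V x \<bullet> W x))"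
    by (subst torus_integral_diff)
      (auto simp: torus_integral_mult torus_integral_minus lap_u uA
        intro!: smooth_on_imp_continuous_on smooth_intros smooth_on_lap smoothV smoothW continuous_intros)
  finally show ?hessian by (simp add: inner_diff_left)
qed

text \<open>Normalising \<open>u + t V + s W\<close>; its norm is at least \<open>R\<close>, so no smallness of \<open>t, s\<close> is needed.\<close>
lemma variation2_exists:
  fixes u :: "real \<times> real \<Rightarrow> 'n::euclidean_space"
  assumes u: "torus_sphere_map R u" and R: "R > 0" and V: "V \<in> sections u" and W: "W \<in> sections u"
  obtains \<Phi> where "variation2 R u \<Phi>" "\<And>x. vector_derivative (\<lambda>t. \<Phi> t 0 x) (at 0) = V x"
    "\<And>x. vector_derivative (\<lambda>s. \<Phi> 0 s x) (at 0) = W x"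
proof -
  define y where "y t s x = u x + t *\<^sub>R V x + s *\<^sub>R W x" for t s x
  define \<Phi> where "\<Phi> t s x = (R * (y t s x \<bullet> y t s x) powr (- 1 / 2)) *\<^sub>R y t s x" for t s x
  have props: "smooth_on UNIV u" "smooth_on UNIV V" "smooth_on UNIV W"
    "doubly_periodic u" "doubly_periodic V" "doubly_periodic W"
    using torus_sphere_mapD[OF u] sectionsD[OF V] sectionsD[OF W] by blast+
  have uu: "u x \<bullet> u x = R\<^sup>2" and uV: "V x \<bullet> u x = 0" and uW: "W x \<bullet> u x = 0" for x
    using torus_sphere_mapD[OF u] sectionsD[OF V] sectionsD[OF W] by blast+
  \<comment> \<open>Tangency of \<open>V\<close> and \<open>W\<close> removes the cross terms with
    \<open>u\<close>, so the norm never falls below \<open>R\<close>.\<close>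
  have yy: "y t s x \<bullet> y t s x = R\<^sup>2 + (t *\<^sub>R V x + s *\<^sub>R W x) \<bullet> (t *\<^sub>R V x + s *\<^sub>R W x)" for t s x
    using uV[of x] uW[of x]
    by (simp add: y_def uu inner_add_left inner_add_right inner_commute algebra_simps)
  have yy_pos: "y t s x \<bullet> y t s x > 0" for t s x
    unfolding yy using R by (simp add: add_pos_nonneg)
  have y_smooth: "smooth_on UNIV (\<lambda>z. y (fst z) (fst (snd z)) (snd (snd z)))"
  proof -
    have L: "bounded_linear (\<lambda>z::real \<times> real \<times> real \<times> real. snd (snd z))"
      "bounded_linear (\<lambda>z::real \<times> real \<times> real \<times> real. fst (snd z))"
      by (intro bounded_linear_intros)+
    have c: "smooth_on UNIV (\<lambda>z::real \<times> real \<times> real \<times> real. f (snd (snd z)))" if "smooth_on UNIV f" for f :: "_ \<Rightarrow> 'n"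
      using that by (intro smooth_on_compose_linear[OF open_UNIV open_UNIV L(1)]) auto
    show ?thesis unfolding y_def
      by (intro smooth_intros c props open_UNIV smooth_on_bounded_linear L bounded_linear_fst)
  qed
  have \<Phi>_smooth: "smooth_on UNIV (\<lambda>z. \<Phi> (fst z) (fst (snd z)) (snd (snd z)))"
    unfolding \<Phi>_def by (intro smooth_intros smooth_on_powr y_smooth open_UNIV yy_pos)
  have sphere_map: "torus_sphere_map R (\<Phi> t s)" for t s
    unfolding torus_sphere_map_def
  proof (intro conjI allI)
    have "smooth_on UNIV (y t s)"
      unfolding y_def[abs_def] by (intro smooth_intros props open_UNIV)
    then show "smooth_on UNIV (\<Phi> t s)"
      unfolding \<Phi>_def[abs_def] by (intro smooth_intros smooth_on_powr open_UNIV yy_pos)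
    show "doubly_periodic (\<Phi> t s)"
      using props(4-6) by (simp add: doubly_periodic_def \<Phi>_def y_def)
    show "\<Phi> t s x \<in> sphere 0 R" for x
    proof -
      have "(y t s x \<bullet> y t s x) powr (- 1 / 2) = inverse (norm (y t s x))"
        using yy_pos[of t s x] by (simp add: powr_minus powr_half_sqrt norm_eq_sqrt_inner)
      then show ?thesis
        using R yy_pos[of t s x] by (simp add: \<Phi>_def)
    qed
  qed
  have norm0: "R * (R\<^sup>2) powr (- 1 / 2) = 1"
    using R by (simp add: powr_minus powr_half_sqrt)
  have "\<Phi> 0 0 = u"
    using norm0 by (simp add: fun_eq_iff \<Phi>_def yy) (simp add: y_def)
  moreover have "(\<lambda>(t, s, x). \<Phi> t s x) = (\<lambda>z. \<Phi> (fst z) (fst (snd z)) (snd (snd z)))"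
    by (auto simp: fun_eq_iff)
  then have "smooth_on ({-1<..<1} \<times> {-1<..<1} \<times> UNIV) (\<lambda>(t, s, x). \<Phi> t s x)"
    using smooth_on_compose_linear[OF _ open_UNIV bounded_linear_ident _ \<Phi>_smooth, of "{-1<..<1} \<times> {-1<..<1} \<times> UNIV"]
    by (simp add: open_Times)
  ultimately have var: "variation2 R u \<Phi>"
    unfolding variation2_def using sphere_map by (auto intro!: exI[of _ 1])
  \<comment> \<open>The normalising factor is \<open>1\<close> at \<open>\<tau> = 0\<close> and
    depends on \<open>\<tau>\<close> through its square only, so its first derivative vanishes there
    and the velocity is that of the unnormalised line.\<close>
  have vel: "((\<lambda>\<tau>. (R * (R\<^sup>2 + \<tau>\<^sup>2 * c) powr (- 1 / 2)) *\<^sub>R (a + \<tau> *\<^sub>R b)) has_vector_derivative b) (at 0)"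
    for c and a b :: 'n
  proof -
    have "((\<lambda>\<tau>. R * (R\<^sup>2 + \<tau>\<^sup>2 * c) powr (- 1 / 2)) has_real_derivative 0) (at 0)"
      using R by (auto intro!: derivative_eq_intros)
    moreover have "((\<lambda>\<tau>. a + \<tau> *\<^sub>R b) has_vector_derivative b) (at 0)"
      by (auto intro!: derivative_eq_intros)
    ultimately show ?thesis
      using has_vector_derivative_scaleR norm0 by fastforce
  qed
  have "vector_derivative (\<lambda>t. \<Phi> t 0 x) (at 0) = V x" for x
    using vel[of "V x \<bullet> V x" "u x" "V x"]
    by (intro vector_derivative_at) (simp add: \<Phi>_def yy power2_eq_square mult.assoc, simp add: y_def)
  moreover have "vector_derivative (\<lambda>s. \<Phi> 0 s x) (at 0) = W x" for x
    using vel[of "W x \<bullet> W x" "u x" "W x"]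
    by (intro vector_derivative_at) (simp add: \<Phi>_def yy power2_eq_square mult.assoc, simp add: y_def)
  ultimately show ?thesis using that var by blast
qed

text \<open>The orthogonal projection of \<open>- lap V - \<kappa> V\<close> onto the tangent
  spaces. For a section \<open>V\<close> only the Laplacian has a component along \<open>u\<close>,
  and \<open>inverse (R\<^sup>2)\<close> normalises \<open>u\<close>.\<close>

definition jacobi_rep ::
  "real \<Rightarrow> real \<Rightarrow> (real \<times> real \<Rightarrow> 'n::euclidean_space) \<Rightarrow> (real \<times> real \<Rightarrow> 'n) \<Rightarrow> real \<times> real \<Rightarrow> 'n" where
  "jacobi_rep R \<kappa> u V x = - lap V x - \<kappa> *\<^sub>R V x + ((lap V x \<bullet> u x) * inverse (R\<^sup>2)) *\<^sub>R u x"

lemma torus_integral_jacobi_rep: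
  assumes "\<And>x. W x \<bullet> u x = 0"
  shows "torus_integral (\<lambda>x. jacobi_rep R \<kappa> u V x \<bullet> W x) = torus_integral (\<lambda>x. (- lap V x - \<kappa> *\<^sub>R V x) \<bullet> W x)"
  using assms by (simp add: jacobi_rep_def inner_add_left inner_commute[of "u _"])

lemma jacobi_rep_section:
  assumes u: "torus_sphere_map R u" "R > 0" and V: "V \<in> sections u"
  shows "jacobi_rep R \<kappa> u V \<in> sections u"
proof -
  have props: "smooth_on UNIV u" "smooth_on UNIV V" "doubly_periodic u" "doubly_periodic V"
    using torus_sphere_mapD[OF u(1)] sectionsD[OF V] by blast+
  have uu: "u x \<bullet> u x = R\<^sup>2" and uV: "V x \<bullet> u x = 0" for x
    using torus_sphere_mapD[OF u(1)] sectionsD[OF V] by blast+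
  have "smooth_on UNIV (jacobi_rep R \<kappa> u V)"
    unfolding jacobi_rep_def[abs_def] by (intro smooth_intros smooth_on_lap props open_UNIV)
  moreover have "doubly_periodic (jacobi_rep R \<kappa> u V)"
    using props doubly_periodic_lap[OF props(2,4)] by (simp add: doubly_periodic_def jacobi_rep_def)
  moreover have "jacobi_rep R \<kappa> u V x \<bullet> u x = 0" for x
    using u(2) by (simp add: jacobi_rep_def inner_add_left inner_diff_left uu uV)
  ultimately show ?thesis by (rule sectionsI)
qed

text \<open>Existence is the second variation formula, whose normal part is invisible to tangent
  test fields. For uniqueness, the difference of two candidates is a section and hence the velocity
  of an admissible variation; testing with it shows that its square integrates to zero.\<close>

lemma jacobi_eq:
  fixes u :: "real \<times> real \<Rightarrow> 'n::euclidean_space"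
  assumes u: "torus_sphere_map R u" "R > 0" and lap_u: "\<And>x. lap u x = - \<kappa> *\<^sub>R u x"
    and V: "V \<in> sections u"
  shows "jacobi R u V = jacobi_rep R \<kappa> u V"
  unfolding jacobi_def
proof (rule the_equality)
  have hess: "deriv (\<lambda>t. deriv (\<lambda>s. energy (\<Phi> t s)) 0) 0
      = torus_integral (\<lambda>x. jacobi_rep R \<kappa> u V x \<bullet> vector_derivative (\<lambda>s. \<Phi> 0 s x) (at 0))"
    if "variation2 R u \<Phi>" "\<And>x. vector_derivative (\<lambda>t. \<Phi> t 0 x) (at 0) = V x" for \<Phi>
  proof -
    have V': "(\<lambda>x. vector_derivative (\<lambda>t. \<Phi> t 0 x) (at 0)) = V"
      by (intro ext that(2))
    show ?thesis
      unfolding second_variation_energy(1)[OF u(1) lap_u that(1)] that(2) V'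
      by (rule torus_integral_jacobi_rep[symmetric]) (rule second_variation_energy(2)[OF u(1) lap_u that(1)])
  qed
  show "jacobi_rep R \<kappa> u V \<in> sections u \<and>
     (\<forall>\<Phi>. variation2 R u \<Phi> \<and> (\<forall>x. vector_derivative (\<lambda>t. \<Phi> t 0 x) (at 0) = V x) \<longrightarrow>
        deriv (\<lambda>t. deriv (\<lambda>s. energy (\<Phi> t s)) 0) 0 =
        torus_integral (\<lambda>x. jacobi_rep R \<kappa> u V x \<bullet> vector_derivative (\<lambda>s. \<Phi> 0 s x) (at 0)))"
    by (intro conjI allI impI jacobi_rep_section[OF u V] hess; (elim conjE allE)?)
  fix U assume U: "U \<in> sections u \<and>
     (\<forall>\<Phi>. variation2 R u \<Phi> \<and> (\<forall>x. vector_derivative (\<lambda>t. \<Phi> t 0 x) (at 0) = V x) \<longrightarrow>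
        deriv (\<lambda>t. deriv (\<lambda>s. energy (\<Phi> t s)) 0) 0 =
        torus_integral (\<lambda>x. U x \<bullet> vector_derivative (\<lambda>s. \<Phi> 0 s x) (at 0)))"
  let ?J = "jacobi_rep R \<kappa> u V"
  \<comment> \<open>The test direction is the difference itself.\<close>
  define W where "W x = U x - ?J x" for x
  have sU: "smooth_on UNIV U" "doubly_periodic U" "\<And>x. U x \<bullet> u x = 0"
    and sJ: "smooth_on UNIV ?J" "doubly_periodic ?J" "\<And>x. ?J x \<bullet> u x = 0"
    by (fact sectionsD[OF conjunct1[OF U]] sectionsD[OF jacobi_rep_section[OF u V]])+
  have sW: "smooth_on UNIV W" unfolding W_def[abs_def] by (intro smooth_intros sU sJ open_UNIV)
  have W: "W \<in> sections u"
    using sU sJ sW by (intro sectionsI) (simp_all add: doubly_periodic_def W_def inner_diff_left)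
  obtain \<Phi> where \<Phi>: "variation2 R u \<Phi>" "\<And>x. vector_derivative (\<lambda>t. \<Phi> t 0 x) (at 0) = V x"
    "\<And>x. vector_derivative (\<lambda>s. \<Phi> 0 s x) (at 0) = W x"
    using variation2_exists[OF u V W] by blast
  have "torus_integral (\<lambda>x. U x \<bullet> W x) = torus_integral (\<lambda>x. ?J x \<bullet> W x)"
    using U[THEN conjunct2, rule_format, of \<Phi>] hess[OF \<Phi>(1,2)] \<Phi>(1,2) unfolding \<Phi>(3) by metis
  moreover have "torus_integral (\<lambda>x. U x \<bullet> W x - ?J x \<bullet> W x) = torus_integral (\<lambda>x. U x \<bullet> W x) - torus_integral (\<lambda>x. ?J x \<bullet> W x)"
    by (intro torus_integral_diff smooth_on_imp_continuous_on smooth_intros open_UNIV sU sJ sW)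
  ultimately have W0: "torus_integral (\<lambda>x. W x \<bullet> W x) = 0"
    by (simp add: W_def inner_diff_left)
  have "W x = 0" for x
    by (rule torus_integral_square_eq_0[OF smooth_on_imp_continuous_on[OF sW] sectionsD(2)[OF W] W0])
  then show "U = ?J" unfolding W_def by (intro ext) simp
qed

text \<open>Against sections the projection drops out, and Green's formula is symmetric. This moves
  the operator from an unknown eigensection to an explicit mode.\<close>

lemma jacobi_rep_self_adjoint:
  fixes u :: "real \<times> real \<Rightarrow> 'n::euclidean_space"
  assumes V: "V \<in> sections u" and W: "W \<in> sections u"
  shows "torus_integral (\<lambda>x. jacobi_rep R \<kappa> u V x \<bullet> W x) = torus_integral (\<lambda>x. V x \<bullet> jacobi_rep R \<kappa> u W x)"
proof -
  have V': "smooth_on UNIV V" "doubly_periodic V" "\<And>x. V x \<bullet> u x = 0"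
    and W': "smooth_on UNIV W" "doubly_periodic W" "\<And>x. W x \<bullet> u x = 0"
    using sectionsD[OF V] sectionsD[OF W] by blast+
  have eq: "torus_integral (\<lambda>x. (- lap A x - \<kappa> *\<^sub>R A x) \<bullet> B x)
      = - torus_integral (\<lambda>x. lap A x \<bullet> B x) - \<kappa> * torus_integral (\<lambda>x. A x \<bullet> B x)"
    if "smooth_on UNIV A" "smooth_on UNIV B" for A B :: "real \<times> real \<Rightarrow> 'n"
  proof -
    have "torus_integral (\<lambda>x. - (lap A x \<bullet> B x) - \<kappa> * (A x \<bullet> B x))
      = torus_integral (\<lambda>x. - (lap A x \<bullet> B x)) - torus_integral (\<lambda>x. \<kappa> * (A x \<bullet> B x))"
      by (intro torus_integral_diff smooth_on_imp_continuous_on smooth_intros smooth_on_lap that open_UNIV)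
    then show ?thesis by (simp add: inner_diff_left torus_integral_minus torus_integral_mult)
  qed
  have "torus_integral (\<lambda>x. lap V x \<bullet> W x) = torus_integral (\<lambda>x. lap W x \<bullet> V x)"
    using torus_integral_Dirichlet[OF V'(1,2) W'(1,2)] torus_integral_Dirichlet[OF W'(1,2) V'(1,2)]
    by (simp add: inner_commute)
  then show ?thesis
    using torus_integral_jacobi_rep[OF W'(3), where R=R and \<kappa>=\<kappa> and V=V] torus_integral_jacobi_rep[OF V'(3), where R=R and \<kappa>=\<kappa> and V=W]
      eq[OF V'(1) W'(1)] eq[OF W'(1) V'(1)]
    by (simp add: inner_commute)
qed

section \<open>Fourier modes\<close>

text \<open>The phase treats sines and cosines together: differentiation merely shifts it by
  \<open>pi / 2\<close>.\<close>

definition tmode :: "int \<Rightarrow> int \<Rightarrow> real \<Rightarrow> real \<times> real \<Rightarrow> real" where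
  "tmode m n \<phi> x = cos (of_int m * fst x + of_int n * snd x + \<phi>)"

lemma tmode_plus_pi: "tmode m n (\<phi> + pi) x = - tmode m n \<phi> x"
  by (simp add: tmode_def flip: add.assoc)

text \<open>Opposite frequencies carry the same functions; this is why only half of the lattice
  points count.\<close>

lemma tmode_neg: "tmode (- m) (- n) \<phi> x = tmode m n (- \<phi>) x"
  unfolding tmode_def by (subst cos_minus[symmetric]) (simp add: algebra_simps)

text \<open>All phases of one frequency lie in the span of two of them, so later vanishing
  statements need only the phases \<open>0\<close> and \<open>pi / 2\<close>.\<close>

lemma tmode_phase: "tmode m n \<phi> x = cos \<phi> * tmode m n 0 x + sin \<phi> * tmode m n (pi / 2) x"
  by (simp add: tmode_def cos_add)

lemma tmode_mult:
  "tmode m n \<phi> x * tmode m' n' \<psi> x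
    = 1 / 2 * tmode (m - m') (n - n') (\<phi> - \<psi>) x + 1 / 2 * tmode (m + m') (n + n') (\<phi> + \<psi>) x"
  by (simp add: tmode_def cos_times_cos algebra_simps)

lemma smooth_on_tmode: "smooth_on UNIV (tmode m n \<phi>)"
  unfolding tmode_def[abs_def]
  by (intro smooth_intros smooth_on_bounded_linear bounded_linear_fst bounded_linear_snd open_UNIV)

lemma continuous_on_tmode: "continuous_on UNIV (tmode m n \<phi>)"
  by (rule smooth_on_imp_continuous_on[OF smooth_on_tmode])

lemma doubly_periodic_tmode: "doubly_periodic (tmode m n \<phi>)"
proof -
  have "cos (a + 2 * pi * of_int k) = cos a" for a and k :: int
    by (simp add: cos_add cos_int_2pin sin_int_2pin)
  from this[of "of_int m * fst x + of_int n * snd x + \<phi>" m for x]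
    this[of "of_int m * fst x + of_int n * snd x + \<phi>" n for x]
  show ?thesis by (auto simp: doubly_periodic_def tmode_def algebra_simps)
qed

lemma dird_tmode:
  "dird v (tmode m n \<phi>) x = (of_int m * fst v + of_int n * snd v) * tmode m n (\<phi> + pi / 2) x"
proof -
  have "(tmode m n \<phi> has_derivative
      (\<lambda>v. - sin (of_int m * fst x + of_int n * snd x + \<phi>) * (of_int m * fst v + of_int n * snd v))) (at x)"
    unfolding tmode_def[abs_def] by (auto intro!: derivative_eq_intros)
  from dird_eqI[OF this, of v] show ?thesis
    by (simp add: tmode_def cos_add sin_add algebra_simps)
qed

lemma torus_integral_const: "torus_integral (\<lambda>x. c) = c * pi\<^sup>2"
  by (simp add: torus_integral_eq content_Pair power2_eq_square)

lemma torus_integral_tmode: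
  "torus_integral (tmode m n \<phi>) = (if m = 0 \<and> n = 0 then cos \<phi> * pi\<^sup>2 else 0)"
proof (cases "m = 0 \<and> n = 0")
  case True
  then show ?thesis by (simp add: tmode_def[abs_def] torus_integral_const)
next
  case False
  then have "m\<^sup>2 + n\<^sup>2 \<noteq> 0" by (simp add: sum_power2_eq_zero_iff)
  then have k: "(of_int m)\<^sup>2 + (of_int n)\<^sup>2 \<noteq> (0::real)"
    by (metis of_int_add of_int_eq_0_iff of_int_power)
  \<comment> \<open>Differentiating along \<open>(m, n)\<close> itself yields the factor
    \<open>m^2 + n^2\<close>, nonzero here; the phase \<open>- pi / 2\<close> compensates the
    shift.\<close>
  have "torus_integral (dird (of_int m, of_int n) (tmode m n (\<phi> - pi / 2))) = 0"
    by (rule torus_integral_dird[OF smooth_on_tmode doubly_periodic_tmode])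
  then have "torus_integral (tmode m n \<phi>) = 0"
    using k False by (auto simp: dird_tmode[abs_def] torus_integral_mult simp flip: power2_eq_square)
  then show ?thesis using False by auto
qed

lemma torus_integral_tmode_mult:
  "torus_integral (\<lambda>x. tmode m n \<phi> x * tmode m' n' \<psi> x)
    = ((if m = m' \<and> n = n' then cos (\<phi> - \<psi>) else 0) + (if m = - m' \<and> n = - n' then cos (\<phi> + \<psi>) else 0)) * pi\<^sup>2 / 2"
proof -
  have "torus_integral (\<lambda>x. tmode m n \<phi> x * tmode m' n' \<psi> x)
    = 1 / 2 * torus_integral (tmode (m - m') (n - n') (\<phi> - \<psi>)) + 1 / 2 * torus_integral (tmode (m + m') (n + n') (\<phi> + \<psi>))"
    unfolding tmode_mult
    by (subst torus_integral_add) (intro continuous_on_mult_left continuous_on_tmode | simp only: torus_integral_mult)+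
  moreover have "m + m' = 0 \<and> n + n' = 0 \<longleftrightarrow> m = - m' \<and> n = - n'"
    "m - m' = 0 \<and> n - n' = 0 \<longleftrightarrow> m = m' \<and> n = n'" by auto
  ultimately show ?thesis
    unfolding torus_integral_tmode
    by (cases "m = m' \<and> n = n'"; cases "m = - m' \<and> n = - n'"; simp only: simp_thms if_True if_False)
      (simp_all add: field_simps)
qed

section \<open>Completeness of the trigonometric system\<close>

text \<open>
  Powers of this kernel are trigonometric polynomials concentrating at \<open>p\<close>, which rules out
  \<open>f p > 0\<close> when all Fourier coefficients of \<open>f\<close> vanish.
\<close>
definition peak_kernel :: "real \<times> real \<Rightarrow> real \<times> real \<Rightarrow> real" where
  "peak_kernel p x = (2 + cos (fst x - fst p) + cos (snd x - snd p)) / 4"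

lemma continuous_on_peak_kernel: "continuous_on A (peak_kernel p)"
  unfolding peak_kernel_def[abs_def] by (intro continuous_intros) simp

lemma peak_kernel_bounds: "0 \<le> peak_kernel p x" "peak_kernel p x \<le> 1" "peak_kernel p p = 1"
proof -
  note cos = cos_ge_minus_one[of "fst x - fst p"] cos_ge_minus_one[of "snd x - snd p"]
    cos_le_one[of "fst x - fst p"] cos_le_one[of "snd x - snd p"]
  have "0 \<le> (2 + a + b) / 4 \<and> (2 + a + b) / 4 \<le> 1" if "- 1 \<le> a" "- 1 \<le> b" "a \<le> 1" "b \<le> 1" for a b :: real
    using that by simp
  from this[OF cos] show "0 \<le> peak_kernel p x" "peak_kernel p x \<le> 1"
    unfolding peak_kernel_def by blast+
  show "peak_kernel p p = 1" by (simp add: peak_kernel_def)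
qed

text \<open>The value \<open>1\<close> forces both coordinate differences to be multiples of
  \<open>2 * pi\<close>. As \<open>p\<close> is an interior point they are smaller than a period in
  absolute value, so no periodic copy of \<open>p\<close> lies in the closed square.\<close>

lemma peak_kernel_less_1:
  assumes p: "p \<in> box (0, 0) (2 * pi, 2 * pi)" and x: "x \<in> cbox (0, 0) (2 * pi, 2 * pi)" and "x \<noteq> p"
  shows "peak_kernel p x < 1"
proof (rule ccontr)
  assume "\<not> peak_kernel p x < 1"
  then have "2 + cos (fst x - fst p) + cos (snd x - snd p) \<ge> 4"
    by (simp add: peak_kernel_def)
  moreover note cos_le_one[of "fst x - fst p"] cos_le_one[of "snd x - snd p"]
  ultimately have c: "cos (fst x - fst p) = 1" "cos (snd x - snd p) = 1"
    by (intro antisym; linarith)+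
  have zero: "a = 0" if a: "cos a = 1" "\<bar>a\<bar> < 2 * pi" for a :: real
  proof -
    obtain k :: int where k: "a = of_int k * 2 * pi" using a(1) by (auto simp: cos_one_2pi_int)
    then have "\<bar>of_int k\<bar> * (2 * pi) < 1 * (2 * pi)" using a(2) by (simp add: abs_mult)
    then have "\<bar>of_int k :: real\<bar> < 1" by (rule mult_right_less_imp_less) simp
    then have "k = 0" by linarith
    then show ?thesis using k by simp
  qed
  have "\<bar>fst x - fst p\<bar> < 2 * pi" "\<bar>snd x - snd p\<bar> < 2 * pi"
    using p x by (cases x, cases p; auto simp: box_def cbox_def Basis_prod_def)+
  with c zero have "fst x = fst p" "snd x = snd p" by fastforce+
  with \<open>x \<noteq> p\<close> show False by (simp add: prod_eq_iff)
qed

text \<open>The kernel is a trigonometric polynomial, so by the product formula each new coefficient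
  is a combination of five old ones.\<close>

lemma tmode_coeff_peak_kernel:
  assumes f: "continuous_on UNIV f" and z: "\<And>m n \<phi>. torus_integral (\<lambda>x. f x * tmode m n \<phi> x) = 0"
  shows "torus_integral (\<lambda>x. f x * peak_kernel p x * tmode m n \<phi> x) = 0"
proof -
  have cos1: "cos (fst x - fst p) = tmode 1 0 (- fst p) x" and cos2: "cos (snd x - snd p) = tmode 0 1 (- snd p) x" for x
    by (simp_all add: tmode_def)
  have eq: "f x * peak_kernel p x * tmode m n \<phi> x
     = 1 / 2 * (f x * tmode m n \<phi> x)
     + (1 / 8 * (f x * tmode (1 - m) (0 - n) (- fst p - \<phi>) x)
     + (1 / 8 * (f x * tmode (1 + m) (0 + n) (- fst p + \<phi>) x)
     + (1 / 8 * (f x * tmode (0 - m) (1 - n) (- snd p - \<phi>) x)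
     + 1 / 8 * (f x * tmode (0 + m) (1 + n) (- snd p + \<phi>) x))))" for x
  proof -
    have "f x * peak_kernel p x * tmode m n \<phi> x = 1 / 2 * (f x * tmode m n \<phi> x)
      + 1 / 4 * (f x * (tmode 1 0 (- fst p) x * tmode m n \<phi> x))
      + 1 / 4 * (f x * (tmode 0 1 (- snd p) x * tmode m n \<phi> x))"
      unfolding peak_kernel_def cos1 cos2 by (simp add: field_simps)
    then show ?thesis unfolding tmode_mult by (simp add: algebra_simps)
  qed
  have c: "continuous_on UNIV (\<lambda>x. f x * tmode m n \<phi> x)" for m n \<phi>
    by (intro continuous_on_mult f continuous_on_tmode)
  show ?thesis
    unfolding eq
    by (simp only: torus_integral_add torus_integral_mult c continuous_on_mult_left continuous_on_add z mult_zero_right add_0_right)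
qed

text \<open>Near \<open>p\<close> the function is positive and the kernel exceeds \<open>r'\<close>;
  where positivity is not known the kernel is at most \<open>r < r'\<close>. For large
  \<open>N\<close> the positive part, of order \<open>r' ^ N\<close>, beats the rest, of order
  \<open>r ^ N\<close>.\<close>

lemma continuous_on_pos_coeff_nonzero:
  fixes f :: "real \<times> real \<Rightarrow> real"
  assumes f: "continuous_on UNIV f" and p: "p \<in> box (0, 0) (2 * pi, 2 * pi)" "f p > 0"
  shows "\<exists>N. torus_integral (\<lambda>x. f x * peak_kernel p x ^ N) \<noteq> 0"
proof (rule ccontr)
  assume "\<not> ?thesis"
  then have zero: "torus_integral (\<lambda>x. f x * peak_kernel p x ^ N) = 0" for N by blast
  let ?B = "cbox (0, 0) (2 * pi, 2 * pi) :: (real \<times> real) set"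
  let ?q = "peak_kernel p"
  define \<eta> where "\<eta> = f p / 2"
  have \<eta>: "\<eta> > 0" "f p > \<eta>" using p(2) by (simp_all add: \<eta>_def)
  define U where "U = {x. \<eta> < f x} \<inter> box (0, 0) (2 * pi, 2 * pi)"
  have U: "open U" "p \<in> U"
    using f p \<eta> by (auto simp: U_def intro!: open_Int open_Collect_less continuous_on_const)
  \<comment> \<open>Inserting a corner makes nonemptiness immediate, so a maximum point exists; the
    corner differs from the interior point \<open>p\<close>.\<close>
  have "compact (insert (0, 0) (?B - U))"
    using compact_diff[OF compact_cbox U(1)] by simp
  then obtain y where y: "y \<in> insert (0, 0) (?B - U)" "\<And>x. x \<in> insert (0, 0) (?B - U) \<Longrightarrow> ?q x \<le> ?q y"
    using continuous_attains_sup[OF _ _ continuous_on_peak_kernel] by (metis insert_not_empty)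
  have "(0, 0) \<in> ?B" by (simp add: cbox_Pair_eq)
  moreover have "(0, 0) \<noteq> p" using p(1) by (auto simp: box_def Basis_prod_def)
  ultimately have y1: "?q y < 1"
    using y(1) U(2) by (intro peak_kernel_less_1[OF p(1)]) auto
  \<comment> \<open>The values \<open>r\<close> and \<open>r'\<close> divide the interval from
    \<open>?q y\<close> to \<open>1\<close> into thirds; this also makes \<open>r\<close> positive
    even if \<open>?q y = 0\<close>.\<close>
  define r where "r = (1 + 2 * ?q y) / 3"
  define r' where "r' = (2 + ?q y) / 3"
  have r: "?q y \<le> r" "0 < r" "r < r'" "r' < 1"
    using y1 peak_kernel_bounds(1)[of p y] by (simp_all add: r_def r'_def)
  define O' where "O' = U \<inter> {x. r' < ?q x}"
  have "open O'" "p \<in> O'"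
    using U r(4) by (auto simp: O'_def peak_kernel_bounds intro!: open_Int open_Collect_less continuous_on_const continuous_on_peak_kernel)
  then obtain c d where cd: "cbox c d \<subseteq> O'" "p \<in> box c d"
    by (rule open_contains_cbox)
  have cdB: "cbox c d \<subseteq> ?B" using cd(1) box_subset_cbox by (force simp: O'_def U_def)
  have cont_pos: "measure lborel (cbox c d) > 0"
    using cd(2) by (auto simp: content_pos_lt_eq box_def intro: less_trans)
  obtain M where M: "M > 0" "\<And>x. x \<in> ?B \<Longrightarrow> \<bar>f x\<bar> \<le> M"
  proof -
    have "bounded (f ` ?B)"
      by (intro compact_imp_bounded compact_continuous_image continuous_on_subset[OF f] compact_cbox subset_UNIV)
    then show ?thesis using that unfolding bounded_pos by auto
  qed
  have bound: "\<eta> * measure lborel (cbox c d) * r' ^ N \<le> M * measure lborel ?B * r ^ N" for N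
  proof -
    \<comment> \<open>A step function below the integrand: the possible negative part is charged
      everywhere, the positive part only on the small box, so the integral is explicit.\<close>
    have int: "((\<lambda>x. (if x \<in> cbox c d then \<eta> * r' ^ N else 0) - M * r ^ N) has_integral
       measure lborel (cbox c d) *\<^sub>R (\<eta> * r' ^ N) - measure lborel ?B *\<^sub>R (M * r ^ N)) ?B"
      by (intro has_integral_diff has_integral_const iffD2[OF has_integral_restrict[OF cdB]])
    have "(\<lambda>x. f x * ?q x ^ N) integrable_on ?B"
      by (intro torus_integrable continuous_intros f continuous_on_peak_kernel)
    then have int': "((\<lambda>x. f x * ?q x ^ N) has_integral 0) ?B"
      using zero[of N] by (simp add: torus_integral_eq has_integral_iff)
    have "(if x \<in> cbox c d then \<eta> * r' ^ N else 0) - M * r ^ N \<le> f x * ?q x ^ N" if x: "x \<in> ?B" for x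
    proof (cases "x \<in> U")
      case True
      then have fx: "\<eta> \<le> f x" by (simp add: U_def)
      have "(if x \<in> cbox c d then \<eta> * r' ^ N else 0) \<le> f x * ?q x ^ N"
      proof (cases "x \<in> cbox c d")
        case True
        then have "r' \<le> ?q x" using cd(1) by (auto simp: O'_def)
        then show ?thesis
          using True fx \<eta> r by (auto intro!: mult_mono power_mono)
      qed (use fx \<eta> peak_kernel_bounds(1)[of p x] in auto)
      moreover have "M * r ^ N \<ge> 0" using M r by simp
      ultimately show ?thesis by linarith
    next
      case False
      then have "x \<notin> cbox c d" using cd(1) by (auto simp: O'_def)
      have "\<bar>f x * ?q x ^ N\<bar> = \<bar>f x\<bar> * ?q x ^ N"
        by (simp add: abs_mult peak_kernel_bounds power_abs)
      also have "\<dots> \<le> M * r ^ N"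
        using M x False order_trans[OF y(2) r(1)] peak_kernel_bounds(1)[of p x] by (intro mult_mono power_mono) auto
      finally show ?thesis using \<open>x \<notin> cbox c d\<close> by auto
    qed
    from has_integral_le[OF int int' this] show ?thesis by (simp add: algebra_simps)
  qed
  \<comment> \<open>The powers of \<open>r' / r > 1\<close> are unbounded, while
    \<open>bound\<close> keeps them below this quotient.\<close>
  obtain N where N: "M * measure lborel ?B / (\<eta> * measure lborel (cbox c d)) < (r' / r) ^ N"
    using real_arch_pow[of "r' / r"] r by auto
  then show False
    using bound[of N] \<eta> cont_pos r by (simp add: field_simps)
qed

text \<open>The peak argument excludes positive values of both \<open>f\<close> and
  \<open>- f\<close> at interior points; continuity covers the boundary of the square.\<close>

lemma tmode_complete:
  fixes f :: "real \<times> real \<Rightarrow> real"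
  assumes f: "continuous_on UNIV f" "doubly_periodic f"
    and z: "\<And>m n \<phi>. torus_integral (\<lambda>x. f x * tmode m n \<phi> x) = 0"
  shows "f x = 0"
proof (rule doubly_periodic_eq_0[OF f(2)])
  let ?b = "box (0, 0) (2 * pi, 2 * pi) :: (real \<times> real) set"
  have nonpos: "g p \<le> 0" if p: "p \<in> ?b" and g: "continuous_on UNIV g"
    and gz: "\<And>m n \<phi>. torus_integral (\<lambda>x. g x * tmode m n \<phi> x) = 0" for g p
  proof (rule ccontr)
    assume "\<not> g p \<le> 0"
    then obtain N where N: "torus_integral (\<lambda>x. g x * peak_kernel p x ^ N) \<noteq> 0"
      using continuous_on_pos_coeff_nonzero[OF g p] by auto
    have "continuous_on UNIV (\<lambda>x. g x * peak_kernel p x ^ N) \<and>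
       (\<forall>m n \<phi>. torus_integral (\<lambda>x. g x * peak_kernel p x ^ N * tmode m n \<phi> x) = 0)"
    proof (induction N)
      case (Suc N)
      have "continuous_on UNIV (\<lambda>x. g x * peak_kernel p x ^ Suc N)"
        by (intro continuous_intros g continuous_on_peak_kernel)
      moreover have "torus_integral (\<lambda>x. g x * peak_kernel p x ^ Suc N * tmode m n \<phi> x) = 0" for m n \<phi>
        using tmode_coeff_peak_kernel[of "\<lambda>x. g x * peak_kernel p x ^ N" p m n \<phi>] Suc
        by (simp add: mult_ac)
      ultimately show ?case by blast
    qed (use g gz in auto)
    \<comment> \<open>The mode of frequency zero and phase zero is the constant
      \<open>1\<close>.\<close>
    then have "torus_integral (\<lambda>x. g x * peak_kernel p x ^ N * tmode 0 0 0 x) = 0" by blast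
    with N show False by (simp add: tmode_def)
  qed
  have f0: "f p = 0" if "p \<in> ?b" for p
    using nonpos[OF that f(1) z] nonpos[OF that continuous_on_minus[OF f(1)]] z
    by (fastforce simp: torus_integral_minus)
  have "?b \<noteq> {}" by (auto simp: box_ne_empty Basis_prod_def)
  then have "closure ?b = cbox (0, 0) (2 * pi, 2 * pi)" by (rule closure_box)
  then show "f x = 0" if "x \<in> cbox (0, 0) (2 * pi, 2 * pi)" for x
    using continuous_constant_on_closure[OF continuous_on_subset[OF f(1) subset_UNIV] f0] that by blast
qed

text \<open>A biorthogonal system: the functionals are diagonal on the \<open>v i\<close>, which
  gives independence, and jointly injective on \<open>E\<close>, which gives spanning. Linearity is
  asked on \<open>E\<close> only, because the integral pairings are additive on smooth
  fields.\<close>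

lemma edim_eq_card:
  fixes E :: "'a::real_vector set"
  assumes E: "subspace E" and I: "finite I" and v: "\<And>i. i \<in> I \<Longrightarrow> v i \<in> E"
    and add: "\<And>i x y. i \<in> I \<Longrightarrow> x \<in> E \<Longrightarrow> y \<in> E \<Longrightarrow> L i (x + y) = L i x + (L i y :: real)"
    and scale: "\<And>i x c. i \<in> I \<Longrightarrow> x \<in> E \<Longrightarrow> L i (c *\<^sub>R x) = c * L i x"
    and diag: "\<And>i. i \<in> I \<Longrightarrow> L i (v i) \<noteq> 0"
    and off: "\<And>i j. i \<in> I \<Longrightarrow> j \<in> I \<Longrightarrow> i \<noteq> j \<Longrightarrow> L i (v j) = 0"
    and inj: "\<And>x. x \<in> E \<Longrightarrow> (\<And>i. i \<in> I \<Longrightarrow> L i x = 0) \<Longrightarrow> x = 0"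
  shows "edim E = enat (card I)"
proof -
  have L_sum: "L i (\<Sum>j\<in>J. a j *\<^sub>R v j) = (\<Sum>j\<in>J. a j * L i (v j))"
    if "i \<in> I" "J \<subseteq> I" for i J a
    using finite_subset[OF that(2) I] that(2)
  proof (induction J rule: finite_induct)
    case empty
    show ?case using scale[OF that(1) subspace_0[OF E], of 0] by simp
  next
    case (insert j J)
    then have "(\<Sum>j\<in>J. a j *\<^sub>R v j) \<in> E" "a j *\<^sub>R v j \<in> E" "v j \<in> E"
      using v by (auto intro!: subspace_sum subspace_scale E)
    then show ?case using insert by (simp add: add scale that(1))
  qed
  have L_sum': "L i (\<Sum>j\<in>I. a j *\<^sub>R v j) = a i * L i (v i)" if "i \<in> I" for i a
  proof -
    have "(\<Sum>j\<in>I. a j * L i (v j)) = (\<Sum>j\<in>I. if j = i then a i * L i (v i) else 0)"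
      using off that by (intro sum.cong) auto
    then show ?thesis using L_sum[OF that subset_refl] I that by simp
  qed
  have inj_v: "inj_on v I"
    using diag off by (intro inj_onI) metis
  have span: "E = span (v ` I)"
  proof
    show "span (v ` I) \<subseteq> E" using v E by (intro span_minimal) auto
    show "E \<subseteq> span (v ` I)"
    proof
      fix x assume x: "x \<in> E"
      \<comment> \<open>The only possible expansion of \<open>x\<close>; every functional
        annihilates the difference.\<close>
      let ?s = "\<Sum>j\<in>I. (L j x / L j (v j)) *\<^sub>R v j"
      have s: "?s \<in> E" using v by (intro subspace_sum subspace_scale E)
      have "x + (-1) *\<^sub>R ?s = 0"
      proof (rule inj)
        show "x + (-1) *\<^sub>R ?s \<in> E" by (intro subspace_add subspace_scale E x s)
        show "L i (x + (-1) *\<^sub>R ?s) = 0" if "i \<in> I" for i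
          using that diag[OF that]
          by (simp only: add[OF that x subspace_scale[OF E s]] scale[OF that s] L_sum'[OF that]) simp
      qed
      then have "x = ?s" by simp
      moreover have "?s \<in> span (v ` I)"
        by (intro span_sum span_scale span_base imageI)
      ultimately show "x \<in> span (v ` I)" by simp
    qed
  qed
  have "independent (v ` I)"
  proof
    assume "dependent (v ` I)"
    then obtain a w where a: "w \<in> v ` I" "a w \<noteq> 0" "(\<Sum>w\<in>v ` I. a w *\<^sub>R w) = 0"
      using dependent_finite[of "v ` I"] I by auto
    then obtain i where i: "i \<in> I" "w = v i" by auto
    have "(\<Sum>j\<in>I. a (v j) *\<^sub>R v j) = 0" using a(3) by (simp add: sum.reindex inj_v)
    then have "a (v i) * L i (v i) = 0"
      using L_sum'[OF i(1), of "\<lambda>j. a (v j)"] scale[OF i(1) subspace_0[OF E], of 0] by simp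
    then show False using a(2) i diag by simp
  qed
  then have "dim E = card I"
    using dim_span_eq_card_independent span card_image[OF inj_v] by metis
  then show ?thesis using span I unfolding edim_def by auto
qed

section \<open>The Jacobi operator of the Clifford torus\<close>

definition circ1 :: "real \<times> real \<Rightarrow> real ^ 4" where
  "circ1 x = cos (fst x) *\<^sub>R axis 1 1 + sin (fst x) *\<^sub>R axis 2 1"

definition tan1 :: "real \<times> real \<Rightarrow> real ^ 4" where
  "tan1 x = - sin (fst x) *\<^sub>R axis 1 1 + cos (fst x) *\<^sub>R axis 2 1"

definition circ2 :: "real \<times> real \<Rightarrow> real ^ 4" where
  "circ2 x = cos (snd x) *\<^sub>R axis 3 1 + sin (snd x) *\<^sub>R axis 4 1"

definition tan2 :: "real \<times> real \<Rightarrow> real ^ 4" where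
  "tan2 x = - sin (snd x) *\<^sub>R axis 3 1 + cos (snd x) *\<^sub>R axis 4 1"

text \<open>Normal to the torus inside the sphere, being orthogonal to \<open>circ1 + circ2\<close>.
  It is left with squared length \<open>2\<close>, which avoids roots in the formulas.\<close>

definition nrm :: "real \<times> real \<Rightarrow> real ^ 4" where
  "nrm x = circ1 x - circ2 x"

lemmas frame_defs = circ1_def tan1_def circ2_def tan2_def

lemma axis_inner_4:
  "(axis 1 1 :: real ^ 4) \<bullet> axis 1 1 = 1" "(axis 2 1 :: real ^ 4) \<bullet> axis 2 1 = 1"
  "(axis 3 1 :: real ^ 4) \<bullet> axis 3 1 = 1" "(axis 4 1 :: real ^ 4) \<bullet> axis 4 1 = 1"
  "(axis 1 1 :: real ^ 4) \<bullet> axis 2 1 = 0" "(axis 2 1 :: real ^ 4) \<bullet> axis 1 1 = 0"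
  "(axis 1 1 :: real ^ 4) \<bullet> axis 3 1 = 0" "(axis 3 1 :: real ^ 4) \<bullet> axis 1 1 = 0"
  "(axis 1 1 :: real ^ 4) \<bullet> axis 4 1 = 0" "(axis 4 1 :: real ^ 4) \<bullet> axis 1 1 = 0"
  "(axis 2 1 :: real ^ 4) \<bullet> axis 3 1 = 0" "(axis 3 1 :: real ^ 4) \<bullet> axis 2 1 = 0"
  "(axis 2 1 :: real ^ 4) \<bullet> axis 4 1 = 0" "(axis 4 1 :: real ^ 4) \<bullet> axis 2 1 = 0"
  "(axis 3 1 :: real ^ 4) \<bullet> axis 4 1 = 0" "(axis 4 1 :: real ^ 4) \<bullet> axis 3 1 = 0"
  by (simp_all add: inner_axis_axis)

lemma frame_inner:
  "circ1 x \<bullet> circ1 x = 1" "tan1 x \<bullet> tan1 x = 1" "circ2 x \<bullet> circ2 x = 1" "tan2 x \<bullet> tan2 x = 1"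
  "circ1 x \<bullet> tan1 x = 0" "tan1 x \<bullet> circ1 x = 0" "circ2 x \<bullet> tan2 x = 0" "tan2 x \<bullet> circ2 x = 0"
  "circ1 x \<bullet> circ2 x = 0" "circ2 x \<bullet> circ1 x = 0" "circ1 x \<bullet> tan2 x = 0" "tan2 x \<bullet> circ1 x = 0"
  "tan1 x \<bullet> circ2 x = 0" "circ2 x \<bullet> tan1 x = 0" "tan1 x \<bullet> tan2 x = 0" "tan2 x \<bullet> tan1 x = 0"
  by (simp_all add: frame_defs inner_add_left inner_add_right inner_diff_left inner_diff_right axis_inner_4 flip: power2_eq_square)

lemma frame_expansion:
  "v = (v \<bullet> circ1 x) *\<^sub>R circ1 x + (v \<bullet> tan1 x) *\<^sub>R tan1 x + (v \<bullet> circ2 x) *\<^sub>R circ2 x + (v \<bullet> tan2 x) *\<^sub>R tan2 x"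
proof -
  have *: "(a * c + b * s) * c - (b * c - a * s) * s = a" "(a * c + b * s) * s + (b * c - a * s) * c = b"
    if "c\<^sup>2 + s\<^sup>2 = 1" for a b c s :: real
    using that by algebra+
  have inner: "v \<bullet> circ1 x = v $ 1 * cos (fst x) + v $ 2 * sin (fst x)" "v \<bullet> tan1 x = v $ 2 * cos (fst x) - v $ 1 * sin (fst x)"
    "v \<bullet> circ2 x = v $ 3 * cos (snd x) + v $ 4 * sin (snd x)" "v \<bullet> tan2 x = v $ 4 * cos (snd x) - v $ 3 * sin (snd x)"
    by (simp_all add: frame_defs inner_add_right inner_diff_right inner_axis)
  show ?thesis
    using *[of "cos (fst x)" "sin (fst x)" "v $ 1" "v $ 2"] *[of "cos (snd x)" "sin (snd x)" "v $ 3" "v $ 4"]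
    unfolding inner by (simp add: vec_eq_iff forall_4 frame_defs axis_def algebra_simps)
qed

lemma smooth_on_frame:
  "smooth_on UNIV circ1" "smooth_on UNIV tan1" "smooth_on UNIV circ2" "smooth_on UNIV tan2" "smooth_on UNIV nrm"
  unfolding frame_defs[abs_def] nrm_def[abs_def]
  by (intro smooth_intros smooth_on_bounded_linear bounded_linear_fst bounded_linear_snd open_UNIV)+

lemma doubly_periodic_frame:
  "doubly_periodic circ1" "doubly_periodic tan1" "doubly_periodic circ2" "doubly_periodic tan2" "doubly_periodic nrm"
  by (simp_all add: doubly_periodic_def frame_defs nrm_def)

lemma dird_frame:
  "dird v circ1 = (\<lambda>x. fst v *\<^sub>R tan1 x)" "dird v tan1 = (\<lambda>x. (- fst v) *\<^sub>R circ1 x)"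
  "dird v circ2 = (\<lambda>x. snd v *\<^sub>R tan2 x)" "dird v tan2 = (\<lambda>x. (- snd v) *\<^sub>R circ2 x)"
  unfolding frame_defs[abs_def]
  by (rule ext, rule dird_eqI, (auto intro!: derivative_eq_intros simp: algebra_simps)[1])+

lemma clifford_torus_eq: "clifford_torus x = (1 / 2) *\<^sub>R (circ1 x + circ2 x)"
  by (simp add: clifford_torus_def split_beta vec_eq_iff forall_4 frame_defs axis_def vector_def)

section \<open>The Laplacian and the Jacobi operator on frame modes\<close>

lemma dird_tmode_scaleR:
  assumes Z: "smooth_on UNIV Z" and dZ: "dird v Z = (\<lambda>x. \<alpha> *\<^sub>R Z' x)"
  shows "dird v (\<lambda>x. tmode m n \<phi> x *\<^sub>R Z x)
    = (\<lambda>x. (of_int m * fst v + of_int n * snd v) *\<^sub>R (tmode m n (\<phi> + pi / 2) x *\<^sub>R Z x) + \<alpha> *\<^sub>R (tmode m n \<phi> x *\<^sub>R Z' x))"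
proof
  fix x
  have "((\<lambda>x. tmode m n \<phi> x *\<^sub>R Z x) has_derivative
      (\<lambda>v. tmode m n \<phi> x *\<^sub>R dird v Z x + dird v (tmode m n \<phi>) x *\<^sub>R Z x)) (at x)"
    by (rule has_derivative_scaleR[OF smooth_on_has_derivative[OF smooth_on_tmode] smooth_on_has_derivative[OF Z]]) simp_all
  from dird_eqI[OF this, of v]
  show "dird v (\<lambda>x. tmode m n \<phi> x *\<^sub>R Z x) x
    = (of_int m * fst v + of_int n * snd v) *\<^sub>R (tmode m n (\<phi> + pi / 2) x *\<^sub>R Z x) + \<alpha> *\<^sub>R (tmode m n \<phi> x *\<^sub>R Z' x)"
    by (simp add: dZ dird_tmode mult.commute)
qed

lemma smooth_on_tmode_scaleR: "smooth_on UNIV Z \<Longrightarrow> smooth_on UNIV (\<lambda>x. tmode m n \<phi> x *\<^sub>R Z x)"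
  by (intro smooth_intros smooth_on_tmode open_UNIV)

lemma doubly_periodic_tmode_scaleR: "doubly_periodic Z \<Longrightarrow> doubly_periodic (\<lambda>x. tmode m n \<phi> x *\<^sub>R Z x)"
  using doubly_periodic_tmode[of m n \<phi>] by (simp add: doubly_periodic_def)

text \<open>The derivative rotates the pair \<open>Z\<close>, \<open>Z'\<close> at speed
  \<open>\<alpha>\<close> while the scalar mode oscillates at frequency \<open>k\<close>; the cross
  term is where the coupling of tangential and radial components comes from.\<close>

lemma dird_dird_tmode_scaleR:
  fixes m n :: int and v :: "real \<times> real"
  assumes Z: "smooth_on UNIV Z" "smooth_on UNIV Z'"
    and d: "dird v Z = (\<lambda>x. \<alpha> *\<^sub>R Z' x)" "dird v Z' = (\<lambda>x. (- \<alpha>) *\<^sub>R Z x)"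
  defines "k \<equiv> of_int m * fst v + of_int n * snd v"
  shows "dird v (dird v (\<lambda>x. tmode m n \<phi> x *\<^sub>R Z x)) x
    = - (k\<^sup>2 + \<alpha>\<^sup>2) *\<^sub>R (tmode m n \<phi> x *\<^sub>R Z x) + (2 * k * \<alpha>) *\<^sub>R (tmode m n (\<phi> + pi / 2) x *\<^sub>R Z' x)"
proof -
  note s = smooth_on_tmode_scaleR[OF Z(1)] smooth_on_tmode_scaleR[OF Z(2)]
  have "dird v (dird v (\<lambda>x. tmode m n \<phi> x *\<^sub>R Z x)) x
    = dird v (\<lambda>x. k *\<^sub>R (tmode m n (\<phi> + pi / 2) x *\<^sub>R Z x) + \<alpha> *\<^sub>R (tmode m n \<phi> x *\<^sub>R Z' x)) x"
    by (simp only: dird_tmode_scaleR[OF Z(1) d(1)] k_def)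
  also have "\<dots> = k *\<^sub>R dird v (\<lambda>x. tmode m n (\<phi> + pi / 2) x *\<^sub>R Z x) x + \<alpha> *\<^sub>R dird v (\<lambda>x. tmode m n \<phi> x *\<^sub>R Z' x) x"
    by (simp only: dird_add[OF smooth_on_scaleR[OF open_UNIV smooth_on_const s(1)] smooth_on_scaleR[OF open_UNIV smooth_on_const s(2)] UNIV_I]
        dird_cmul[OF s(1) UNIV_I] dird_cmul[OF s(2) UNIV_I])
  also have "\<dots> = k *\<^sub>R (k *\<^sub>R (tmode m n (\<phi> + pi) x *\<^sub>R Z x) + \<alpha> *\<^sub>R (tmode m n (\<phi> + pi / 2) x *\<^sub>R Z' x))
     + \<alpha> *\<^sub>R (k *\<^sub>R (tmode m n (\<phi> + pi / 2) x *\<^sub>R Z' x) + (- \<alpha>) *\<^sub>R (tmode m n \<phi> x *\<^sub>R Z x))"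
    unfolding dird_tmode_scaleR[OF Z(1) d(1)] dird_tmode_scaleR[OF Z(2) d(2)] k_def[symmetric] by (simp add: add.assoc)
  also have "\<dots> = - (k\<^sup>2 + \<alpha>\<^sup>2) *\<^sub>R (tmode m n \<phi> x *\<^sub>R Z x) + (2 * k * \<alpha>) *\<^sub>R (tmode m n (\<phi> + pi / 2) x *\<^sub>R Z' x)"
    unfolding tmode_plus_pi by (simp add: algebra_simps power2_eq_square flip: scaleR_add_left)
  finally show ?thesis .
qed

lemma lap_tmode_scaleR:
  "lap (\<lambda>x. tmode m n \<phi> x *\<^sub>R circ1 x) x = - (4 * (of_int (m\<^sup>2 + n\<^sup>2) + 1)) *\<^sub>R (tmode m n \<phi> x *\<^sub>R circ1 x)
     + (8 * of_int m) *\<^sub>R (tmode m n (\<phi> + pi / 2) x *\<^sub>R tan1 x)"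
  "lap (\<lambda>x. tmode m n \<phi> x *\<^sub>R tan1 x) x = - (4 * (of_int (m\<^sup>2 + n\<^sup>2) + 1)) *\<^sub>R (tmode m n \<phi> x *\<^sub>R tan1 x)
     - (8 * of_int m) *\<^sub>R (tmode m n (\<phi> + pi / 2) x *\<^sub>R circ1 x)"
  "lap (\<lambda>x. tmode m n \<phi> x *\<^sub>R circ2 x) x = - (4 * (of_int (m\<^sup>2 + n\<^sup>2) + 1)) *\<^sub>R (tmode m n \<phi> x *\<^sub>R circ2 x)
     + (8 * of_int n) *\<^sub>R (tmode m n (\<phi> + pi / 2) x *\<^sub>R tan2 x)"
  "lap (\<lambda>x. tmode m n \<phi> x *\<^sub>R tan2 x) x = - (4 * (of_int (m\<^sup>2 + n\<^sup>2) + 1)) *\<^sub>R (tmode m n \<phi> x *\<^sub>R tan2 x)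
     - (8 * of_int n) *\<^sub>R (tmode m n (\<phi> + pi / 2) x *\<^sub>R circ2 x)"
proof -
  \<comment> \<open>Each rotating pair is listed in both orders; exchanging its members replaces the
    speed by its negative, hence the double minus signs.\<close>
  have 1: "dird v circ1 = (\<lambda>x. fst v *\<^sub>R tan1 x)" "dird v tan1 = (\<lambda>x. (- fst v) *\<^sub>R circ1 x)"
    "dird v tan1 = (\<lambda>x. (- fst v) *\<^sub>R circ1 x)" "dird v circ1 = (\<lambda>x. (- (- fst v)) *\<^sub>R tan1 x)"
    "dird v circ2 = (\<lambda>x. snd v *\<^sub>R tan2 x)" "dird v tan2 = (\<lambda>x. (- snd v) *\<^sub>R circ2 x)"
    "dird v tan2 = (\<lambda>x. (- snd v) *\<^sub>R circ2 x)" "dird v circ2 = (\<lambda>x. (- (- snd v)) *\<^sub>R tan2 x)" for v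
    by (simp_all add: dird_frame)
  note d = dird_dird_tmode_scaleR[OF smooth_on_frame(1,2) 1(1,2)] dird_dird_tmode_scaleR[OF smooth_on_frame(2,1) 1(3,4)]
    dird_dird_tmode_scaleR[OF smooth_on_frame(3,4) 1(5,6)] dird_dird_tmode_scaleR[OF smooth_on_frame(4,3) 1(7,8)]
  show "lap (\<lambda>x. tmode m n \<phi> x *\<^sub>R circ1 x) x = - (4 * (of_int (m\<^sup>2 + n\<^sup>2) + 1)) *\<^sub>R (tmode m n \<phi> x *\<^sub>R circ1 x)
     + (8 * of_int m) *\<^sub>R (tmode m n (\<phi> + pi / 2) x *\<^sub>R tan1 x)"
    by (simp add: lap_def torus_frame_def d algebra_simps power2_eq_square)
  show "lap (\<lambda>x. tmode m n \<phi> x *\<^sub>R tan1 x) x = - (4 * (of_int (m\<^sup>2 + n\<^sup>2) + 1)) *\<^sub>R (tmode m n \<phi> x *\<^sub>R tan1 x)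
     - (8 * of_int m) *\<^sub>R (tmode m n (\<phi> + pi / 2) x *\<^sub>R circ1 x)"
    by (simp add: lap_def torus_frame_def d algebra_simps power2_eq_square)
  show "lap (\<lambda>x. tmode m n \<phi> x *\<^sub>R circ2 x) x = - (4 * (of_int (m\<^sup>2 + n\<^sup>2) + 1)) *\<^sub>R (tmode m n \<phi> x *\<^sub>R circ2 x)
     + (8 * of_int n) *\<^sub>R (tmode m n (\<phi> + pi / 2) x *\<^sub>R tan2 x)"
    by (simp add: lap_def torus_frame_def d algebra_simps power2_eq_square)
  show "lap (\<lambda>x. tmode m n \<phi> x *\<^sub>R tan2 x) x = - (4 * (of_int (m\<^sup>2 + n\<^sup>2) + 1)) *\<^sub>R (tmode m n \<phi> x *\<^sub>R tan2 x)
     - (8 * of_int n) *\<^sub>R (tmode m n (\<phi> + pi / 2) x *\<^sub>R circ2 x)"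
    by (simp add: lap_def torus_frame_def d algebra_simps power2_eq_square)
qed

lemma lap_add:
  assumes "smooth_on UNIV f" "smooth_on UNIV g"
  shows "lap (\<lambda>x. f x + g x) x = lap f x + lap g x"
proof -
  have "dird e (\<lambda>x. f x + g x) = (\<lambda>x. dird e f x + dird e g x)" for e
    by (rule ext) (rule dird_add[OF assms UNIV_I])
  then show ?thesis
    using dird_add[OF smooth_on_dird smooth_on_dird UNIV_I, OF assms]
    by (simp add: lap_def sum.distrib)
qed

lemma lap_cmul:
  assumes "smooth_on UNIV f"
  shows "lap (\<lambda>x. c *\<^sub>R f x) x = c *\<^sub>R lap f x"
proof -
  have "dird e (\<lambda>x. c *\<^sub>R f x) = (\<lambda>x. c *\<^sub>R dird e f x)" for e
    by (rule ext) (rule dird_cmul[OF assms UNIV_I])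
  then show ?thesis
    using dird_cmul[OF smooth_on_dird UNIV_I, OF assms]
    by (simp add: lap_def scaleR_sum_right)
qed

lemma torus_sphere_map_clifford_torus: "torus_sphere_map (1 / sqrt 2) clifford_torus"
  unfolding torus_sphere_map_def
proof (intro conjI allI)
  have eq: "clifford_torus = (\<lambda>x. (1 / 2) *\<^sub>R (circ1 x + circ2 x))"
    by (rule ext) (rule clifford_torus_eq)
  show "smooth_on UNIV clifford_torus"
    unfolding eq by (intro smooth_intros smooth_on_frame open_UNIV)
  show "doubly_periodic clifford_torus"
    using doubly_periodic_frame unfolding eq by (simp add: doubly_periodic_def)
  show "clifford_torus x \<in> sphere 0 (1 / sqrt 2)" for x
    by (simp add: eq norm_eq_sqrt_inner inner_add_left inner_add_right frame_inner real_sqrt_divide)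
qed

text \<open>The harmonic map equation into the sphere: the Laplacian is parallel to the position
  vector. The constant is the squared norm \<open>2\<close> of the differential divided by the
  squared radius \<open>1 / 2\<close>.\<close>

lemma lap_clifford_torus: "lap clifford_torus x = - 4 *\<^sub>R clifford_torus x"
proof -
  \<comment> \<open>The map is written with modes of frequency zero, so that the formulas for modes
    apply.\<close>
  have eq: "clifford_torus = (\<lambda>x. (1 / 2) *\<^sub>R (tmode 0 0 0 x *\<^sub>R circ1 x + tmode 0 0 0 x *\<^sub>R circ2 x))"
    by (rule ext) (simp add: clifford_torus_eq tmode_def)
  have "lap clifford_torus x = (1 / 2) *\<^sub>R (lap (\<lambda>x. tmode 0 0 0 x *\<^sub>R circ1 x) x + lap (\<lambda>x. tmode 0 0 0 x *\<^sub>R circ2 x) x)"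
    unfolding eq
    by (subst lap_cmul lap_add; (intro smooth_intros smooth_on_tmode_scaleR smooth_on_frame open_UNIV)?)+ simp
  then show ?thesis
    unfolding lap_tmode_scaleR by (simp add: clifford_torus_eq tmode_def algebra_simps)
qed

abbreviation clifford_jacobi :: "(real \<times> real \<Rightarrow> real ^ 4) \<Rightarrow> real \<times> real \<Rightarrow> real ^ 4" where
  "clifford_jacobi \<equiv> jacobi_rep (1 / sqrt 2) 4 clifford_torus"

lemma jacobi_clifford_torus:
  "V \<in> sections clifford_torus \<Longrightarrow> jacobi (1 / sqrt 2) clifford_torus V = clifford_jacobi V"
  by (rule jacobi_eq[OF torus_sphere_map_clifford_torus _ lap_clifford_torus]) simp_all

lemma clifford_jacobi_eq:
  "clifford_jacobi V x = - lap V x - 4 *\<^sub>R V x + (lap V x \<bullet> (circ1 x + circ2 x) / 2) *\<^sub>R (circ1 x + circ2 x)"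
  by (simp add: jacobi_rep_def clifford_torus_eq power_divide)

lemma tmode_frame_sections:
  "(\<lambda>x. tmode m n \<phi> x *\<^sub>R tan1 x) \<in> sections clifford_torus"
  "(\<lambda>x. tmode m n \<phi> x *\<^sub>R tan2 x) \<in> sections clifford_torus"
  "(\<lambda>x. tmode m n \<phi> x *\<^sub>R nrm x) \<in> sections clifford_torus"
  by (intro sectionsI smooth_on_tmode_scaleR doubly_periodic_tmode_scaleR smooth_on_frame doubly_periodic_frame;
      simp add: clifford_torus_eq nrm_def inner_add_right inner_diff_left frame_inner)+

text \<open>The projection keeps half of a radial component, \<open>nrm / 2\<close> of
  \<open>circ1\<close> and \<open>- nrm / 2\<close> of \<open>circ2\<close>: hence the factor
  \<open>4\<close> from tangent to normal against \<open>8\<close> back, which is symmetric because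
  \<open>nrm\<close> has squared length \<open>2\<close>. The term \<open>- 4 V\<close> cancels the
  curvature of the frame and leaves \<open>4 k\<close> on the diagonal.\<close>

lemma clifford_jacobi_tmode:
  "clifford_jacobi (\<lambda>x. tmode m n \<phi> x *\<^sub>R tan1 x) x
    = (4 * of_int (m\<^sup>2 + n\<^sup>2)) *\<^sub>R (tmode m n \<phi> x *\<^sub>R tan1 x) + (4 * of_int m) *\<^sub>R (tmode m n (\<phi> + pi / 2) x *\<^sub>R nrm x)"
  "clifford_jacobi (\<lambda>x. tmode m n \<phi> x *\<^sub>R tan2 x) x
    = (4 * of_int (m\<^sup>2 + n\<^sup>2)) *\<^sub>R (tmode m n \<phi> x *\<^sub>R tan2 x) - (4 * of_int n) *\<^sub>R (tmode m n (\<phi> + pi / 2) x *\<^sub>R nrm x)"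
  "clifford_jacobi (\<lambda>x. tmode m n \<phi> x *\<^sub>R nrm x) x
    = (4 * of_int (m\<^sup>2 + n\<^sup>2)) *\<^sub>R (tmode m n \<phi> x *\<^sub>R nrm x) - (8 * of_int m) *\<^sub>R (tmode m n (\<phi> + pi / 2) x *\<^sub>R tan1 x)
      + (8 * of_int n) *\<^sub>R (tmode m n (\<phi> + pi / 2) x *\<^sub>R tan2 x)"
proof -
  have two: "v * 2 = 2 *\<^sub>R v" for v :: "real ^ 4"
    by (simp add: scaleR_2 mult_2_right)
  show "clifford_jacobi (\<lambda>x. tmode m n \<phi> x *\<^sub>R tan1 x) x
    = (4 * of_int (m\<^sup>2 + n\<^sup>2)) *\<^sub>R (tmode m n \<phi> x *\<^sub>R tan1 x) + (4 * of_int m) *\<^sub>R (tmode m n (\<phi> + pi / 2) x *\<^sub>R nrm x)"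
    unfolding clifford_jacobi_eq lap_tmode_scaleR
    by (simp add: inner_add_left inner_add_right inner_diff_left frame_inner nrm_def two algebra_simps)
  show "clifford_jacobi (\<lambda>x. tmode m n \<phi> x *\<^sub>R tan2 x) x
    = (4 * of_int (m\<^sup>2 + n\<^sup>2)) *\<^sub>R (tmode m n \<phi> x *\<^sub>R tan2 x) - (4 * of_int n) *\<^sub>R (tmode m n (\<phi> + pi / 2) x *\<^sub>R nrm x)"
    unfolding clifford_jacobi_eq lap_tmode_scaleR
    by (simp add: inner_add_left inner_add_right inner_diff_left frame_inner nrm_def two algebra_simps)
  have "lap (\<lambda>x. tmode m n \<phi> x *\<^sub>R nrm x) x
      = lap (\<lambda>x. tmode m n \<phi> x *\<^sub>R circ1 x) x + (- 1) *\<^sub>R lap (\<lambda>x. tmode m n \<phi> x *\<^sub>R circ2 x) x"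
    unfolding lap_cmul[OF smooth_on_tmode_scaleR[OF smooth_on_frame(3)], symmetric]
    by (subst lap_add[symmetric]) (auto intro!: smooth_intros smooth_on_tmode_scaleR smooth_on_frame simp: nrm_def scaleR_diff_right)
  then have l: "lap (\<lambda>x. tmode m n \<phi> x *\<^sub>R nrm x) x
    = - (4 * (of_int (m\<^sup>2 + n\<^sup>2) + 1)) *\<^sub>R (tmode m n \<phi> x *\<^sub>R (circ1 x - circ2 x))
     + (8 * of_int m) *\<^sub>R (tmode m n (\<phi> + pi / 2) x *\<^sub>R tan1 x) - (8 * of_int n) *\<^sub>R (tmode m n (\<phi> + pi / 2) x *\<^sub>R tan2 x)"
    unfolding lap_tmode_scaleR by (simp add: algebra_simps)
  show "clifford_jacobi (\<lambda>x. tmode m n \<phi> x *\<^sub>R nrm x) x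
    = (4 * of_int (m\<^sup>2 + n\<^sup>2)) *\<^sub>R (tmode m n \<phi> x *\<^sub>R nrm x) - (8 * of_int m) *\<^sub>R (tmode m n (\<phi> + pi / 2) x *\<^sub>R tan1 x)
      + (8 * of_int n) *\<^sub>R (tmode m n (\<phi> + pi / 2) x *\<^sub>R tan2 x)"
    unfolding clifford_jacobi_eq l
    by (simp add: inner_add_left inner_add_right inner_diff_left inner_diff_right frame_inner nrm_def two algebra_simps)
qed

section \<open>Eigenspaces\<close>

definition fcoeff :: "(real \<times> real \<Rightarrow> real ^ 4) \<Rightarrow> (real \<times> real \<Rightarrow> real ^ 4) \<Rightarrow> int \<Rightarrow> int \<Rightarrow> real \<Rightarrow> real" where
  "fcoeff Z V m n \<phi> = torus_integral (\<lambda>x. V x \<bullet> (tmode m n \<phi> x *\<^sub>R Z x))"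

lemma continuous_on_inner_tmode:
  "smooth_on UNIV V \<Longrightarrow> smooth_on UNIV Z \<Longrightarrow> continuous_on UNIV (\<lambda>x. V x \<bullet> (tmode m n \<phi> x *\<^sub>R Z x))"
  by (intro smooth_on_imp_continuous_on smooth_on_inner smooth_on_tmode_scaleR open_UNIV)

lemma fcoeff_plus_pi: "fcoeff Z V m n (\<phi> + pi / 2 + pi / 2) = - fcoeff Z V m n \<phi>"
proof -
  have "\<phi> + pi / 2 + pi / 2 = \<phi> + pi" by simp
  then show ?thesis by (simp only: fcoeff_def tmode_plus_pi scaleR_minus_left inner_minus_right torus_integral_minus)
qed

lemma fcoeff_neg: "fcoeff Z V (- m) (- n) \<phi> = fcoeff Z V m n (- \<phi>)"
  by (simp only: fcoeff_def tmode_neg)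

lemma fcoeff_phase:
  assumes "smooth_on UNIV V" "smooth_on UNIV Z"
  shows "fcoeff Z V m n \<phi> = cos \<phi> * fcoeff Z V m n 0 + sin \<phi> * fcoeff Z V m n (pi / 2)"
proof -
  note c = continuous_on_mult_left[OF continuous_on_inner_tmode[OF assms]]
  have "(cos \<phi> * a + sin \<phi> * b) *\<^sub>R z = cos \<phi> *\<^sub>R (a *\<^sub>R z) + sin \<phi> *\<^sub>R (b *\<^sub>R z)" for a b and z :: "real ^ 4"
    by (simp add: scaleR_add_left)
  then show ?thesis
    unfolding fcoeff_def tmode_phase[of m n \<phi>]
    by (simp only: inner_add_right inner_scaleR_right[of _ "cos \<phi>"] inner_scaleR_right[of _ "sin \<phi>"] torus_integral_add[OF c c] torus_integral_mult)
qed

lemma torus_integral_inner_combination: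
  assumes V: "smooth_on UNIV V" and Z: "smooth_on UNIV Z1" "smooth_on UNIV Z2" "smooth_on UNIV Z3"
  shows "torus_integral (\<lambda>x. V x \<bullet> (a1 *\<^sub>R (tmode m n \<phi>1 x *\<^sub>R Z1 x) + (a2 *\<^sub>R (tmode m n \<phi>2 x *\<^sub>R Z2 x)
        + a3 *\<^sub>R (tmode m n \<phi>3 x *\<^sub>R Z3 x))))
    = a1 * fcoeff Z1 V m n \<phi>1 + (a2 * fcoeff Z2 V m n \<phi>2 + a3 * fcoeff Z3 V m n \<phi>3)"
proof -
  define p where "p Z \<phi> x = V x \<bullet> (tmode m n \<phi> x *\<^sub>R Z x)" for Z \<phi> x
  have p: "continuous_on UNIV (\<lambda>x. a * p Z \<phi> x)" if "smooth_on UNIV Z" for a Z \<phi>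
    unfolding p_def by (intro continuous_on_mult_left continuous_on_inner_tmode V that)
  have "V x \<bullet> (a1 *\<^sub>R (tmode m n \<phi>1 x *\<^sub>R Z1 x) + (a2 *\<^sub>R (tmode m n \<phi>2 x *\<^sub>R Z2 x) + a3 *\<^sub>R (tmode m n \<phi>3 x *\<^sub>R Z3 x)))
      = a1 * p Z1 \<phi>1 x + (a2 * p Z2 \<phi>2 x + a3 * p Z3 \<phi>3 x)" for x
    unfolding p_def by (simp only: inner_add_right inner_scaleR_right)
  moreover have "torus_integral (\<lambda>x. a1 * p Z1 \<phi>1 x + (a2 * p Z2 \<phi>2 x + a3 * p Z3 \<phi>3 x))
      = a1 * torus_integral (p Z1 \<phi>1) + (a2 * torus_integral (p Z2 \<phi>2) + a3 * torus_integral (p Z3 \<phi>3))"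
    unfolding torus_integral_add[OF p[OF Z(1)] continuous_on_add[OF p[OF Z(2)] p[OF Z(3)]]]
      torus_integral_add[OF p[OF Z(2)] p[OF Z(3)]] torus_integral_mult ..
  ultimately show ?thesis by (simp only: fcoeff_def p_def[abs_def])
qed

text \<open>Two phases at one frequency control all phases there and at the opposite frequency, so
  one representative per pair suffices below.\<close>

lemma fcoeff_eq_0:
  assumes "smooth_on UNIV V" "smooth_on UNIV Z" "fcoeff Z V m n 0 = 0" "fcoeff Z V m n (pi / 2) = 0"
  shows "fcoeff Z V m n \<phi> = 0" "fcoeff Z V (- m) (- n) \<phi> = 0"
proof -
  show 1: "fcoeff Z V m n \<phi> = 0" for \<phi>
    by (subst fcoeff_phase[OF assms(1,2)]) (simp add: assms(3,4))
  then show "fcoeff Z V (- m) (- n) \<phi> = 0" unfolding fcoeff_neg .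
qed

text \<open>Completeness kills the components along \<open>tan1\<close>, \<open>tan2\<close> and
  \<open>nrm\<close>; orthogonality to the torus map supplies the fourth direction.\<close>

lemma section_eq_0:
  assumes V: "V \<in> sections clifford_torus"
    and z: "\<And>m n \<phi>. fcoeff tan1 V m n \<phi> = 0" "\<And>m n \<phi>. fcoeff tan2 V m n \<phi> = 0" "\<And>m n \<phi>. fcoeff nrm V m n \<phi> = 0"
  shows "V = 0"
proof
  fix x
  have zero: "V x \<bullet> Z x = 0" if Z: "smooth_on UNIV Z" "doubly_periodic Z" "\<And>m n \<phi>. fcoeff Z V m n \<phi> = 0" for Z
  proof (rule tmode_complete)
    show "continuous_on UNIV (\<lambda>x. V x \<bullet> Z x)"
      by (intro smooth_on_imp_continuous_on smooth_on_inner sectionsD(1)[OF V] Z open_UNIV)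
    show "doubly_periodic (\<lambda>x. V x \<bullet> Z x)"
      using sectionsD(2)[OF V] Z(2) by (simp add: doubly_periodic_def)
    show "torus_integral (\<lambda>x. V x \<bullet> Z x * tmode m n \<phi> x) = 0" for m n \<phi>
      using Z(3)[of m n \<phi>] by (simp add: fcoeff_def mult.commute)
  qed
  have "V x \<bullet> tan1 x = 0" "V x \<bullet> tan2 x = 0" "V x \<bullet> nrm x = 0"
    by (intro zero smooth_on_frame doubly_periodic_frame z)+
  moreover from this(3) have "V x \<bullet> circ1 x = V x \<bullet> circ2 x" by (simp add: nrm_def inner_diff_right)
  moreover have "V x \<bullet> circ1 x + V x \<bullet> circ2 x = 0"
    using sectionsD(3)[OF V, of x] by (simp add: clifford_torus_eq inner_add_right)
  ultimately show "V x = 0 x" by (subst frame_expansion[of "V x" x]) simp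
qed

text \<open>Self-adjointness turns \<open>c\<close> times a coefficient into the pairing of
  \<open>V\<close> with the operator applied to a mode, which is a combination of coefficients at
  the same frequency.\<close>

lemma eigenvector_fcoeff:
  assumes V: "V \<in> sections clifford_torus" and JV: "\<And>x. clifford_jacobi V x = c *\<^sub>R V x"
  defines "d m n \<equiv> c - 4 * of_int (m\<^sup>2 + n\<^sup>2)"
  shows "d m n * fcoeff tan1 V m n \<phi> = 4 * of_int m * fcoeff nrm V m n (\<phi> + pi / 2)"
    "d m n * fcoeff tan2 V m n \<phi> = - 4 * of_int n * fcoeff nrm V m n (\<phi> + pi / 2)"
    "((d m n)\<^sup>2 - 32 * of_int (m\<^sup>2 + n\<^sup>2)) * fcoeff nrm V m n \<phi> = 0"
proof -
  note sV = sectionsD(1)[OF V]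
  have adj: "c * fcoeff Z V m n \<phi> = torus_integral (\<lambda>x. V x \<bullet> clifford_jacobi (\<lambda>x. tmode m n \<phi> x *\<^sub>R Z x) x)"
    if "(\<lambda>x. tmode m n \<phi> x *\<^sub>R Z x) \<in> sections clifford_torus" for Z \<phi>
    using jacobi_rep_self_adjoint[OF V that, of "1 / sqrt 2" 4]
    by (simp only: JV inner_scaleR_left fcoeff_def torus_integral_mult)
  have 1: "d m n * fcoeff tan1 V m n \<phi> = 4 * of_int m * fcoeff nrm V m n (\<phi> + pi / 2)" for \<phi>
    using adj[OF tmode_frame_sections(1), of \<phi>]
      torus_integral_inner_combination[OF sV smooth_on_frame(2,5,5), of "4 * of_int (m\<^sup>2 + n\<^sup>2)" m n \<phi> "4 * of_int m" "\<phi> + pi / 2" 0 0]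
    unfolding clifford_jacobi_tmode d_def by (simp only: scaleR_zero_left add_0_right mult_zero_left left_diff_distrib)
  have 2: "d m n * fcoeff tan2 V m n \<phi> = - 4 * of_int n * fcoeff nrm V m n (\<phi> + pi / 2)" for \<phi>
    using adj[OF tmode_frame_sections(2), of \<phi>]
      torus_integral_inner_combination[OF sV smooth_on_frame(4,5,5), of "4 * of_int (m\<^sup>2 + n\<^sup>2)" m n \<phi> "- (4 * of_int n)" "\<phi> + pi / 2" 0 0]
    unfolding clifford_jacobi_tmode d_def
    by (simp only: scaleR_zero_left add_0_right mult_zero_left left_diff_distrib scaleR_minus_left add_uminus_conv_diff)
  have 3: "d m n * fcoeff nrm V m n \<phi> = - 8 * of_int m * fcoeff tan1 V m n (\<phi> + pi / 2) + 8 * of_int n * fcoeff tan2 V m n (\<phi> + pi / 2)" for \<phi>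
    using adj[OF tmode_frame_sections(3), of \<phi>]
      torus_integral_inner_combination[OF sV smooth_on_frame(5,2,4), of "4 * of_int (m\<^sup>2 + n\<^sup>2)" m n \<phi> "- (8 * of_int m)" "\<phi> + pi / 2"
        "8 * of_int n" "\<phi> + pi / 2"]
    unfolding clifford_jacobi_tmode d_def
    by (simp only: left_diff_distrib scaleR_minus_left add_uminus_conv_diff add.assoc[symmetric])
  show "d m n * fcoeff tan1 V m n \<phi> = 4 * of_int m * fcoeff nrm V m n (\<phi> + pi / 2)"
    "d m n * fcoeff tan2 V m n \<phi> = - 4 * of_int n * fcoeff nrm V m n (\<phi> + pi / 2)"
    by (fact 1 2)+
  \<comment> \<open>Multiplying the normal equation by \<open>d m n\<close> allows the tangential
    ones to be substituted without division, so \<open>d m n = 0\<close> is covered. Two quarter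
    shifts of the phase give the sign.\<close>
  have "(d m n)\<^sup>2 * fcoeff nrm V m n \<phi> = d m n * (d m n * fcoeff nrm V m n \<phi>)"
    by (simp add: power2_eq_square)
  also have "\<dots> = - 8 * of_int m * (d m n * fcoeff tan1 V m n (\<phi> + pi / 2)) + 8 * of_int n * (d m n * fcoeff tan2 V m n (\<phi> + pi / 2))"
    unfolding 3 by (simp add: algebra_simps)
  also have "\<dots> = 32 * of_int (m\<^sup>2 + n\<^sup>2) * fcoeff nrm V m n \<phi>"
    unfolding 1 2 fcoeff_plus_pi by (simp add: algebra_simps power2_eq_square)
  finally show "((d m n)\<^sup>2 - 32 * of_int (m\<^sup>2 + n\<^sup>2)) * fcoeff nrm V m n \<phi> = 0"
    by (simp add: algebra_simps)
qed

text \<open>Off the resonant frequencies the normal coefficients vanish by themselves; and wherever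
  \<open>c\<close> differs from \<open>4 k\<close> the tangential coefficients follow from the
  normal ones.\<close>

lemma eigenvector_eq_0:
  assumes V: "V \<in> sections clifford_torus" and JV: "\<And>x. clifford_jacobi V x = c *\<^sub>R V x"
    and nrm: "\<And>m n \<phi>. (c - 4 * of_int (m\<^sup>2 + n\<^sup>2))\<^sup>2 = 32 * of_int (m\<^sup>2 + n\<^sup>2) \<Longrightarrow> fcoeff nrm V m n \<phi> = 0"
    and tan: "\<And>m n \<phi>. c = 4 * of_int (m\<^sup>2 + n\<^sup>2) \<Longrightarrow> fcoeff tan1 V m n \<phi> = 0 \<and> fcoeff tan2 V m n \<phi> = 0"
  shows "V = 0"
proof -
  note e = eigenvector_fcoeff[OF V JV]
  have C: "fcoeff nrm V m n \<phi> = 0" for m n \<phi>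
    using e(3)[of m n \<phi>] nrm[of m n \<phi>] by auto
  have A: "fcoeff tan1 V m n \<phi> = 0" for m n \<phi>
    using e(1)[of m n \<phi>] tan[of m n \<phi>] C by auto
  have B: "fcoeff tan2 V m n \<phi> = 0" for m n \<phi>
    using e(2)[of m n \<phi>] tan[of m n \<phi>] C by auto
  show ?thesis by (rule section_eq_0[OF V A B C])
qed

lemma jacobi_rep_add:
  assumes "smooth_on UNIV f" "smooth_on UNIV g"
  shows "jacobi_rep R \<kappa> u (\<lambda>x. f x + g x) x = jacobi_rep R \<kappa> u f x + jacobi_rep R \<kappa> u g x"
  by (simp add: jacobi_rep_def lap_add[OF assms] inner_add_left algebra_simps)

lemma jacobi_rep_cmul:
  assumes "smooth_on UNIV f"
  shows "jacobi_rep R \<kappa> u (\<lambda>x. c *\<^sub>R f x) x = c *\<^sub>R jacobi_rep R \<kappa> u f x"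
  by (simp add: jacobi_rep_def lap_cmul[OF assms] algebra_simps)

lemma subspace_sections: "subspace (sections u)"
proof (rule subspaceI)
  show "0 \<in> sections u"
    by (rule sectionsI) (simp_all add: zero_fun_def smooth_on_const doubly_periodic_def)
  show "f + g \<in> sections u" if "f \<in> sections u" "g \<in> sections u" for f g
    using sectionsD[OF that(1)] sectionsD[OF that(2)]
    by (intro sectionsI) (simp_all add: plus_fun_def smooth_on_add doubly_periodic_def inner_add_left)
  show "a *\<^sub>R f \<in> sections u" if "f \<in> sections u" for a f
    using sectionsD[OF that]
    by (intro sectionsI) (simp_all add: scaleR_fun_def smooth_on_scaleR smooth_on_const doubly_periodic_def)
qed

text \<open>From here on the definite description in \<open>jacobi\<close> is replaced by the
  explicit operator.\<close>

lemma jacobi_eigenspace_clifford_torus: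
  "V \<in> jacobi_eigenspace (1 / sqrt 2) clifford_torus c
    \<longleftrightarrow> V \<in> sections clifford_torus \<and> (\<forall>x. clifford_jacobi V x = c *\<^sub>R V x)"
  by (auto simp: jacobi_eigenspace_def jacobi_clifford_torus fun_eq_iff scaleR_fun_def simp del: split_paired_All)

lemma subspace_jacobi_eigenspace: "subspace (jacobi_eigenspace (1 / sqrt 2) clifford_torus c)"
proof (rule subspaceI; unfold jacobi_eigenspace_clifford_torus; intro conjI allI; (elim conjE)?)
  note sub = subspace_sections[of clifford_torus]
  show "0 \<in> sections clifford_torus" by (rule subspace_0[OF sub])
  show "clifford_jacobi 0 x = c *\<^sub>R 0 x" for x
    using jacobi_rep_cmul[OF smooth_on_const[of _ 0], of "1 / sqrt 2" 4 clifford_torus 0 x] by (simp add: zero_fun_def)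
  fix f assume f: "f \<in> sections clifford_torus" "\<forall>x. clifford_jacobi f x = c *\<^sub>R f x"
  show "a *\<^sub>R f \<in> sections clifford_torus" for a by (rule subspace_scale[OF sub f(1)])
  show "clifford_jacobi (a *\<^sub>R f) x = c *\<^sub>R (a *\<^sub>R f) x" for a x
    using jacobi_rep_cmul[OF sectionsD(1)[OF f(1)], of "1 / sqrt 2" 4 clifford_torus a x] spec[OF f(2), of x]
    by (simp add: scaleR_fun_def)
  fix g assume g: "g \<in> sections clifford_torus" "\<forall>x. clifford_jacobi g x = c *\<^sub>R g x"
  show "f + g \<in> sections clifford_torus" by (rule subspace_add[OF sub f(1) g(1)])
  show "clifford_jacobi (f + g) x = c *\<^sub>R (f + g) x" for x
    using jacobi_rep_add[OF sectionsD(1)[OF f(1)] sectionsD(1)[OF g(1)], of "1 / sqrt 2" 4 clifford_torus x]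
      spec[OF f(2), of x] spec[OF g(2), of x]
    by (simp add: plus_fun_def scaleR_add_right)
qed

section \<open>Explicit eigensections and the functionals that detect them\<close>

definition pairing :: "(real \<times> real \<Rightarrow> real ^ 4) \<Rightarrow> (real \<times> real \<Rightarrow> real ^ 4) \<Rightarrow> real" where
  "pairing W V = torus_integral (\<lambda>x. V x \<bullet> W x)"

lemma pairing_add:
  assumes "smooth_on UNIV W" "smooth_on UNIV f" "smooth_on UNIV g"
  shows "pairing W (f + g) = pairing W f + pairing W g"
  by (simp add: pairing_def inner_add_left)
    (intro torus_integral_add smooth_on_imp_continuous_on smooth_on_inner assms open_UNIV)

lemma pairing_scale: "pairing W (a *\<^sub>R f) = a * pairing W f"
  by (simp add: pairing_def scaleR_fun_def torus_integral_mult)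

text \<open>With normal amplitude \<open>1\<close>, the tangential equations for the eigenvalue
  \<open>4 k - d\<close> force these amplitudes, and the normal equation then demands
  \<open>d^2 = 32 k\<close>. Thus \<open>d\<close> is the negative of \<open>d m n\<close> in
  \<open>eigenvector_fcoeff\<close>.\<close>

definition eigmode :: "real \<Rightarrow> int \<Rightarrow> int \<Rightarrow> real \<Rightarrow> real \<times> real \<Rightarrow> real ^ 4" where
  "eigmode d m n \<phi> x = tmode m n \<phi> x *\<^sub>R nrm x
    + ((8 * of_int m / d) *\<^sub>R (tmode m n (\<phi> + pi / 2) x *\<^sub>R tan1 x)
    + (- 8 * of_int n / d) *\<^sub>R (tmode m n (\<phi> + pi / 2) x *\<^sub>R tan2 x))"

lemma eigmode_eigenvector:
  assumes d: "d \<noteq> 0" "d\<^sup>2 = 32 * of_int (m\<^sup>2 + n\<^sup>2)" "c = 4 * of_int (m\<^sup>2 + n\<^sup>2) - d"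
  shows "eigmode d m n \<phi> \<in> jacobi_eigenspace (1 / sqrt 2) clifford_torus c"
  unfolding jacobi_eigenspace_clifford_torus
proof (intro conjI allI)
  let ?C = "\<lambda>x. tmode m n \<phi> x *\<^sub>R nrm x"
  let ?X = "\<lambda>x. tmode m n (\<phi> + pi / 2) x *\<^sub>R tan1 x"
  let ?Y = "\<lambda>x. tmode m n (\<phi> + pi / 2) x *\<^sub>R tan2 x"
  let ?a = "8 * of_int m / d" and ?b = "- 8 * of_int n / d"
  have eq: "eigmode d m n \<phi> = ?C + (?a *\<^sub>R ?X + ?b *\<^sub>R ?Y)"
    by (simp add: fun_eq_iff eigmode_def scaleR_fun_def)
  show "eigmode d m n \<phi> \<in> sections clifford_torus"
    unfolding eq by (intro subspace_add subspace_scale subspace_sections tmode_frame_sections)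
  fix x
  have eigmode_at: "eigmode d m n \<phi> x = ?C x + (?a *\<^sub>R ?X x + ?b *\<^sub>R ?Y x)"
    by (rule eigmode_def)
  note s = smooth_on_tmode_scaleR[OF smooth_on_frame(5)] smooth_on_tmode_scaleR[OF smooth_on_frame(2)] smooth_on_tmode_scaleR[OF smooth_on_frame(4)]
  note s' = smooth_on_scaleR[OF open_UNIV smooth_on_const s(2)] smooth_on_scaleR[OF open_UNIV smooth_on_const s(3)]
  have "clifford_jacobi (eigmode d m n \<phi>) x
      = clifford_jacobi ?C x + (?a *\<^sub>R clifford_jacobi ?X x + ?b *\<^sub>R clifford_jacobi ?Y x)"
    unfolding eigmode_def[abs_def]
    by (simp only: jacobi_rep_add[OF s(1) smooth_on_add[OF open_UNIV s']] jacobi_rep_add[OF s'] jacobi_rep_cmul[OF s(2)] jacobi_rep_cmul[OF s(3)])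
  moreover have "tmode m n (\<phi> + pi / 2 + pi / 2) x = - tmode m n \<phi> x"
    using tmode_plus_pi[of m n \<phi> x] by (simp add: add.assoc)
  ultimately have "clifford_jacobi (eigmode d m n \<phi>) x
      = (4 * of_int (m\<^sup>2 + n\<^sup>2) - 4 * of_int m * ?a + 4 * of_int n * ?b) *\<^sub>R ?C x
      + ((4 * of_int (m\<^sup>2 + n\<^sup>2) * ?a - 8 * of_int m) *\<^sub>R ?X x + (4 * of_int (m\<^sup>2 + n\<^sup>2) * ?b + 8 * of_int n) *\<^sub>R ?Y x)"
    unfolding clifford_jacobi_tmode by (simp add: algebra_simps)
  also have "4 * of_int (m\<^sup>2 + n\<^sup>2) - 4 * of_int m * ?a + 4 * of_int n * ?b = c"
  proof -
    have "4 * of_int m * ?a - 4 * of_int n * ?b = d"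
      using d(1,2) by (simp add: field_simps power2_eq_square)
    then show ?thesis using d(3) by simp
  qed
  also have "4 * of_int (m\<^sup>2 + n\<^sup>2) * ?a - 8 * of_int m = c * ?a"
    using d(1) unfolding d(3) by (simp add: field_simps)
  also have "4 * of_int (m\<^sup>2 + n\<^sup>2) * ?b + 8 * of_int n = c * ?b"
    using d(1) unfolding d(3) by (simp add: field_simps)
  finally show "clifford_jacobi (eigmode d m n \<phi>) x = c *\<^sub>R eigmode d m n \<phi> x"
    unfolding eigmode_at by (simp only: scaleR_add_right scaleR_scaleR mult.assoc)
qed

lemma nrm_inner:
  "nrm x \<bullet> nrm x = 2" "nrm x \<bullet> tan1 x = 0" "tan1 x \<bullet> nrm x = 0" "nrm x \<bullet> tan2 x = 0" "tan2 x \<bullet> nrm x = 0"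
  by (simp_all add: nrm_def inner_diff_left inner_diff_right frame_inner)

lemma eigmode_inner:
  "eigmode d m n \<phi> x \<bullet> nrm x = 2 * tmode m n \<phi> x"
  "eigmode d m n \<phi> x \<bullet> tan1 x = (8 * of_int m / d) * tmode m n (\<phi> + pi / 2) x"
  "eigmode d m n \<phi> x \<bullet> tan2 x = (- 8 * of_int n / d) * tmode m n (\<phi> + pi / 2) x"
  by (simp_all add: eigmode_def inner_add_left inner_diff_left nrm_inner frame_inner)

text \<open>Testing with normal modes sees only the normal part of \<open>eigmode\<close>, so
  biorthogonality reduces to that of scalar modes; the squared length \<open>2\<close> of
  \<open>nrm\<close> cancels the factor one half there.\<close>

lemma pairing_eigmode:
  "pairing (\<lambda>x. tmode m' n' \<psi> x *\<^sub>R nrm x) (eigmode d m n \<phi>)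
    = ((if m = m' \<and> n = n' then cos (\<phi> - \<psi>) else 0) + (if m = - m' \<and> n = - n' then cos (\<phi> + \<psi>) else 0)) * pi\<^sup>2"
proof -
  have "eigmode d m n \<phi> x \<bullet> (tmode m' n' \<psi> x *\<^sub>R nrm x) = 2 * (tmode m n \<phi> x * tmode m' n' \<psi> x)" for x
    by (simp add: eigmode_inner)
  then show ?thesis
    unfolding pairing_def by (simp only: torus_integral_mult torus_integral_tmode_mult)
qed

section \<open>Dimensions of the negative eigenspaces and of the kernel\<close>

lemma sum_squares_int_cases:
  fixes m n :: int
  shows "m\<^sup>2 + n\<^sup>2 = 1 \<Longrightarrow> (m, n) \<in> {(1, 0), (-1, 0), (0, 1), (0, -1)}"
    and "m\<^sup>2 + n\<^sup>2 = 2 \<Longrightarrow> (m, n) \<in> {(1, 1), (-1, -1), (1, -1), (-1, 1)}"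
    and "m\<^sup>2 + n\<^sup>2 = 0 \<Longrightarrow> (m, n) = (0, 0)"
proof -
  have small: "a \<in> {-1, 0, 1}" if "a\<^sup>2 + b\<^sup>2 \<le> 2" for a b :: int
  proof -
    have "a\<^sup>2 \<le> 2" using that zero_le_power2[of b] by linarith
    then have "\<bar>a\<bar>\<^sup>2 < 2\<^sup>2" by simp
    then have "\<bar>a\<bar> < 2" by (rule power2_less_imp_less) simp
    then show ?thesis by auto
  qed
  have mn: "m \<in> {-1, 0, 1}" "n \<in> {-1, 0, 1}" if "m\<^sup>2 + n\<^sup>2 \<le> 2"
    using small[of m n] small[of n m] that by (simp_all add: add.commute)
  show "m\<^sup>2 + n\<^sup>2 = 1 \<Longrightarrow> (m, n) \<in> {(1, 0), (-1, 0), (0, 1), (0, -1)}"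
    using mn by auto
  show "m\<^sup>2 + n\<^sup>2 = 2 \<Longrightarrow> (m, n) \<in> {(1, 1), (-1, -1), (1, -1), (-1, 1)}"
    using mn by auto
  show "m\<^sup>2 + n\<^sup>2 = 0 \<Longrightarrow> (m, n) = (0, 0)"
    by (simp add: sum_power2_eq_zero_iff)
qed

text \<open>For negative \<open>c\<close> the square exceeds \<open>16 k^2\<close>, so
  \<open>16 k^2 < 32 k\<close> and \<open>k\<close> lies strictly between \<open>0\<close> and
  \<open>2\<close>. The root with \<open>c < 0\<close> is then selected.\<close>

lemma negative_eigenvalue:
  fixes k :: int
  assumes "c < 0" "k \<ge> 0" and eq: "(c - 4 * of_int k)\<^sup>2 = 32 * of_int k"
  shows "k = 1" "c = 4 - 4 * sqrt 2"
proof -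
  have "(4 * of_int k)\<^sup>2 < (4 * of_int k - c)\<^sup>2"
    using assms(1,2) by (intro power_strict_mono) auto
  also have "\<dots> = 32 * of_int k" using eq by (simp add: power2_commute)
  finally have "real_of_int k * of_int k < real_of_int k * 2" by (simp add: power2_eq_square)
  then have "k > 0 \<and> k < 2"
    using assms(2) by (cases "k = 0") (auto simp: mult_less_cancel_left)
  then show k: "k = 1" by simp
  have "(4 - c)\<^sup>2 = (4 * sqrt 2)\<^sup>2" using eq k by (simp add: power2_commute power_mult_distrib)
  then have "4 - c = 4 * sqrt 2"
    by (rule power2_eq_imp_eq) (use assms(1) in auto)
  then show "c = 4 - 4 * sqrt 2" by simp
qed

lemma edim_zero: "edim {0 :: 'a::real_vector} = 0"
proof -
  have "dim (span {} :: 'a::real_vector set) = card ({} :: 'a set)"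
    by (rule dim_span_eq_card_independent) (rule independent_empty)
  then show ?thesis
    unfolding edim_def by (auto intro!: exI[of _ "{}"] simp: zero_enat_def)
qed

lemma edim_negative_eigenspace:
  assumes "c < 0" "c \<noteq> 4 - 4 * sqrt 2"
  shows "edim (jacobi_eigenspace (1 / sqrt 2) clifford_torus c) = 0"
proof -
  have "V = 0" if "V \<in> jacobi_eigenspace (1 / sqrt 2) clifford_torus c" for V
  proof (rule eigenvector_eq_0)
    show "V \<in> sections clifford_torus" "clifford_jacobi V x = c *\<^sub>R V x" for x
      using that unfolding jacobi_eigenspace_clifford_torus by blast+
    show "fcoeff nrm V m n \<phi> = 0" if "(c - 4 * of_int (m\<^sup>2 + n\<^sup>2))\<^sup>2 = 32 * of_int (m\<^sup>2 + n\<^sup>2)" for m n \<phi>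
      using negative_eigenvalue(2)[OF assms(1) _ that] assms(2) by simp
    \<comment> \<open>Vacuous: \<open>4 k\<close> is never negative.\<close>
    show "fcoeff tan1 V m n \<phi> = 0 \<and> fcoeff tan2 V m n \<phi> = 0" if "c = 4 * of_int (m\<^sup>2 + n\<^sup>2)" for m n \<phi>
    proof -
      have "(0::real) \<le> 4 * of_int (m\<^sup>2 + n\<^sup>2)" by simp
      with that assms(1) show ?thesis by (metis not_le)
    qed
  qed
  then have "jacobi_eigenspace (1 / sqrt 2) clifford_torus c = {0}"
    using subspace_0[OF subspace_jacobi_eigenspace] by blast
  then show ?thesis by (simp add: edim_zero)
qed

text \<open>Normal coefficients suffice as coordinates, because a negative eigenvalue never equals
  \<open>4 k\<close> and the tangential coefficients are then determined.\<close>

lemma edim_least_eigenspace: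
  "edim (jacobi_eigenspace (1 / sqrt 2) clifford_torus (4 - 4 * sqrt 2)) = 4"
proof -
  let ?c = "4 - 4 * sqrt 2" and ?d = "4 * sqrt 2"
  let ?E = "jacobi_eigenspace (1 / sqrt 2) clifford_torus ?c"
  \<comment> \<open>One of each pair of opposite lattice points on the unit circle, with two
    phases.\<close>
  let ?I = "{(1, 0), (0, 1)} \<times> {0, pi / 2} :: ((int \<times> int) \<times> real) set"
  define v where "v = (\<lambda>((m, n), \<phi>). eigmode ?d m n \<phi>)"
  define W where "W = (\<lambda>((m, n), \<phi>) x. tmode m n \<phi> x *\<^sub>R nrm x)"
  have c: "?c < 0" by simp
  have smooth_W: "smooth_on UNIV (W i)" for i
    unfolding W_def by (cases i) (auto intro: smooth_on_tmode_scaleR smooth_on_frame)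
  have "edim ?E = enat (card ?I)"
  proof (rule edim_eq_card[where v=v and L="\<lambda>i. pairing (W i)"])
    show "subspace ?E" by (rule subspace_jacobi_eigenspace)
    show "finite ?I" by simp
    show "v i \<in> ?E" if "i \<in> ?I" for i
      using that unfolding v_def by (auto intro!: eigmode_eigenvector simp: power_mult_distrib)
    show "pairing (W i) (x + y) = pairing (W i) x + pairing (W i) y" if "x \<in> ?E" "y \<in> ?E" for i x y
      using that unfolding jacobi_eigenspace_clifford_torus by (intro pairing_add smooth_W) (auto dest: sectionsD)
    show "pairing (W i) (a *\<^sub>R x) = a * pairing (W i) x" for i x a by (rule pairing_scale)
    show "pairing (W i) (v i) \<noteq> 0" if "i \<in> ?I" for i
      using that unfolding v_def W_def by (auto simp: pairing_eigmode)
    show "pairing (W i) (v j) = 0" if "i \<in> ?I" "j \<in> ?I" "i \<noteq> j" for i j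
      using that unfolding v_def W_def by (auto simp: pairing_eigmode)
    fix V assume V: "V \<in> ?E" and zero: "\<And>i. i \<in> ?I \<Longrightarrow> pairing (W i) V = 0"
    have VD: "V \<in> sections clifford_torus" "clifford_jacobi V x = ?c *\<^sub>R V x" for x
      using V unfolding jacobi_eigenspace_clifford_torus by blast+
    have z: "fcoeff nrm V m n \<phi> = 0" if "((m, n), \<phi>) \<in> ?I" for m n \<phi>
      using zero[OF that] by (simp add: W_def pairing_def fcoeff_def)
    note f0 = fcoeff_eq_0[OF sectionsD(1)[OF VD(1)] smooth_on_frame(5)]
    have z1: "fcoeff nrm V 1 0 \<phi> = 0" "fcoeff nrm V (- 1) 0 \<phi> = 0" "fcoeff nrm V 0 1 \<phi> = 0" "fcoeff nrm V 0 (- 1) \<phi> = 0" for \<phi>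
      using f0[OF z z, of 1 0] f0[OF z z, of 0 1] by simp_all
    show "V = 0"
    proof (rule eigenvector_eq_0[OF VD])
      show "fcoeff nrm V m n \<phi> = 0" if "(?c - 4 * of_int (m\<^sup>2 + n\<^sup>2))\<^sup>2 = 32 * of_int (m\<^sup>2 + n\<^sup>2)" for m n \<phi>
      proof -
        have "m\<^sup>2 + n\<^sup>2 = 1" by (rule negative_eigenvalue(1)[OF c _ that]) simp
        then show ?thesis using sum_squares_int_cases(1)[of m n] z1 by auto
      qed
      show "fcoeff tan1 V m n \<phi> = 0 \<and> fcoeff tan2 V m n \<phi> = 0" if "?c = 4 * of_int (m\<^sup>2 + n\<^sup>2)" for m n \<phi>
      proof -
        have "(0::real) \<le> 4 * of_int (m\<^sup>2 + n\<^sup>2)" by simp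
        with that c show ?thesis by (metis not_le)
      qed
    qed
  qed
  then show ?thesis by (simp add: card_cartesian_product numeral_eq_enat)
qed

text \<open>At \<open>c = 0\<close> the normal equation allows \<open>k = 2\<close> and
  \<open>k = 0\<close>, and the tangential coefficients are free exactly at \<open>k = 0\<close>. So
  four coupled modes are joined by three frame fields with constant coefficients.\<close>

lemma edim_kernel: "edim (jacobi_eigenspace (1 / sqrt 2) clifford_torus 0) = 7"
proof -
  let ?E = "jacobi_eigenspace (1 / sqrt 2) clifford_torus 0"
  let ?M = "{(1, 1), (1, -1)} \<times> {0, pi / 2} :: ((int \<times> int) \<times> real) set"
  let ?I = "?M <+> {0, 1, 2 :: nat}"
  \<comment> \<open>At \<open>k = 0\<close> the parameter of \<open>eigmode\<close> would be
    \<open>d = 0\<close>, so the constant-coefficient fields form a separate summand and serve as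
    their own test fields. For \<open>k = 2\<close> the parameter is \<open>8\<close>, as
    \<open>8^2 = 32 * 2\<close>.\<close>
  define b where "b j = (if j = 0 then tan1 else if j = 1 then tan2 else nrm)" for j :: nat
  define v where "v = case_sum (\<lambda>((m, n), \<phi>). eigmode 8 m n \<phi>) b"
  define W where "W = case_sum (\<lambda>((m, n), \<phi>) x. tmode m n \<phi> x *\<^sub>R nrm x) b"
  have smooth_W: "smooth_on UNIV (W i)" for i
    unfolding W_def b_def by (cases i) (auto intro: smooth_on_tmode_scaleR smooth_on_frame)
  have t0: "tmode 0 0 \<phi> x = cos \<phi>" for \<phi> x by (simp add: tmode_def)
  have bE: "b j \<in> ?E" for j
    unfolding jacobi_eigenspace_clifford_torus b_def
    using tmode_frame_sections[of 0 0 0] clifford_jacobi_tmode[of 0 0 0] by (simp add: t0)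
  have bb: "pairing (b j) (b j) \<noteq> 0" "i \<in> {0, 1, 2} \<Longrightarrow> j \<in> {0, 1, 2} \<Longrightarrow> i \<noteq> j \<Longrightarrow> pairing (b i) (b j) = 0" for i j
    by (auto simp: pairing_def b_def frame_inner nrm_inner torus_integral_const)
  have wb: "pairing (\<lambda>x. tmode m n \<phi> x *\<^sub>R nrm x) (b j) = 0" if "(m, n) \<noteq> (0, 0)" for m n \<phi> j
    using that by (auto simp: pairing_def b_def nrm_inner frame_inner torus_integral_const torus_integral_mult torus_integral_tmode mult.commute[of _ 2])
  have bv: "pairing (b j) (eigmode d m n \<phi>) = 0" if "(m, n) \<noteq> (0, 0)" for d m n \<phi> j
  proof -
    have "torus_integral (tmode m n \<psi>) = 0" for \<psi>
      using that by (auto simp: torus_integral_tmode)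
    then show ?thesis
      unfolding pairing_def b_def
      by (cases "j = 0"; cases "j = 1"; simp only: simp_thms if_True if_False eigmode_inner torus_integral_mult mult_zero_right)
  qed
  have "edim ?E = enat (card ?I)"
  proof (rule edim_eq_card[where v=v and L="\<lambda>i. pairing (W i)"])
    show "subspace ?E" by (rule subspace_jacobi_eigenspace)
    show "finite ?I" by simp
    show "v i \<in> ?E" if "i \<in> ?I" for i
      using that unfolding v_def by (auto intro!: eigmode_eigenvector bE)
    show "pairing (W i) (x + y) = pairing (W i) x + pairing (W i) y" if "x \<in> ?E" "y \<in> ?E" for i x y
      using that unfolding jacobi_eigenspace_clifford_torus by (intro pairing_add smooth_W) (auto dest: sectionsD)
    show "pairing (W i) (a *\<^sub>R x) = a * pairing (W i) x" for i x a by (rule pairing_scale)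
    show "pairing (W i) (v i) \<noteq> 0" if "i \<in> ?I" for i
      using that unfolding v_def W_def by (auto simp: pairing_eigmode bb)
    show "pairing (W i) (v j) = 0" if "i \<in> ?I" "j \<in> ?I" "i \<noteq> j" for i j
      using that unfolding v_def W_def by (auto simp: pairing_eigmode bb wb bv)
    fix V assume V: "V \<in> ?E" and zero: "\<And>i. i \<in> ?I \<Longrightarrow> pairing (W i) V = 0"
    have VD: "V \<in> sections clifford_torus" "clifford_jacobi V x = 0 *\<^sub>R V x" for x
      using V unfolding jacobi_eigenspace_clifford_torus by blast+
    have z: "fcoeff nrm V m n \<phi> = 0" if "((m, n), \<phi>) \<in> ?M" for m n \<phi>
      using zero[OF InlI[OF that]] by (simp add: W_def pairing_def fcoeff_def)
    note f0 = fcoeff_eq_0[OF sectionsD(1)[OF VD(1)] smooth_on_frame(5)]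
    have z1: "fcoeff nrm V 1 1 \<phi> = 0" "fcoeff nrm V (- 1) (- 1) \<phi> = 0" "fcoeff nrm V 1 (- 1) \<phi> = 0" "fcoeff nrm V (- 1) 1 \<phi> = 0" for \<phi>
      using f0[OF z z, of 1 1] f0[OF z z, of 1 "- 1"] by simp_all
    \<comment> \<open>At frequency zero every phase gives a constant mode, so one test per frame
      field covers all phases.\<close>
    have z0: "fcoeff tan1 V 0 0 \<phi> = 0" "fcoeff tan2 V 0 0 \<phi> = 0" "fcoeff nrm V 0 0 \<phi> = 0" for \<phi>
      using zero[OF InrI, of 0] zero[OF InrI, of 1] zero[OF InrI, of 2]
      by (simp_all add: W_def b_def pairing_def fcoeff_def t0 torus_integral_mult)
    show "V = 0"
    proof (rule eigenvector_eq_0[OF VD])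
      show "fcoeff nrm V m n \<phi> = 0" if "(0 - 4 * real_of_int (m\<^sup>2 + n\<^sup>2))\<^sup>2 = 32 * of_int (m\<^sup>2 + n\<^sup>2)" for m n \<phi>
      proof -
        have "r * (r - 2) = 0" if "(0 - 4 * r)\<^sup>2 = 32 * r" for r :: real
          using that by (simp add: power2_eq_square algebra_simps)
        from this[OF that] have "real_of_int (m\<^sup>2 + n\<^sup>2) * (of_int (m\<^sup>2 + n\<^sup>2) - 2) = 0" .
        then have "real_of_int (m\<^sup>2 + n\<^sup>2) = of_int 0 \<or> real_of_int (m\<^sup>2 + n\<^sup>2) = of_int 2"
          unfolding mult_eq_0_iff by auto
        then have "m\<^sup>2 + n\<^sup>2 = 0 \<or> m\<^sup>2 + n\<^sup>2 = 2"
          unfolding of_int_eq_iff .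
        then show ?thesis using sum_squares_int_cases(2,3)[of m n] z1 z0 by auto
      qed
      show "fcoeff tan1 V m n \<phi> = 0 \<and> fcoeff tan2 V m n \<phi> = 0" if "0 = 4 * real_of_int (m\<^sup>2 + n\<^sup>2)" for m n \<phi>
      proof -
        have "real_of_int (m\<^sup>2 + n\<^sup>2) = 0" by (rule mult_left_cancel[of 4, THEN iffD1]) (use that in simp_all)
        then have "m = 0 \<and> n = 0" by (simp only: of_int_eq_0_iff sum_power2_eq_zero_iff)
        then show ?thesis using z0 by simp
      qed
    qed
  qed
  then show ?thesis by (simp add: card_Plus card_cartesian_product numeral_eq_enat)
qed

theorem theorem4p3:
  shows "index_harm (1 / sqrt 2) clifford_torus = 4 \<and> null_harm (1 / sqrt 2) clifford_torus = 7"
proof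
  let ?E = "jacobi_eigenspace (1 / sqrt 2) clifford_torus" and ?c = "4 - 4 * sqrt 2"
  \<comment> \<open>Every finite partial sum is \<open>0\<close> or \<open>4\<close>, so the
    supremum is attained at the singleton of the only negative eigenvalue.\<close>
  have sum: "(\<Sum>c\<in>F. edim (?E c)) = (if ?c \<in> F then 4 else 0)" if "finite F" "F \<subseteq> {..<0}" for F
  proof -
    have "(\<Sum>c\<in>F. edim (?E c)) = (\<Sum>c\<in>F. if c = ?c then 4 else 0)"
      using that edim_least_eigenspace by (intro sum.cong) (auto intro: edim_negative_eigenspace)
    then show ?thesis using that(1) by simp
  qed
  show "index_harm (1 / sqrt 2) clifford_torus = 4"
    unfolding index_harm_def
  proof (rule antisym)
    show "(SUP F\<in>{F. finite F \<and> F \<subseteq> {..<0}}. \<Sum>c\<in>F. edim (?E c)) \<le> 4"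
      by (rule SUP_least) (auto simp: sum)
    show "4 \<le> (SUP F\<in>{F. finite F \<and> F \<subseteq> {..<0}}. \<Sum>c\<in>F. edim (?E c))"
      by (rule SUP_upper2[of "{?c}"]) (simp_all add: edim_least_eigenspace)
  qed
  have "{V \<in> sections clifford_torus. jacobi (1 / sqrt 2) clifford_torus V = 0} = ?E 0"
    by (simp add: jacobi_eigenspace_def)
  then show "null_harm (1 / sqrt 2) clifford_torus = 7"
    by (simp add: null_harm_def edim_kernel)
qed

end
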